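(* Let $\mathbb{K}$ be a field of characteristic $0$ and $\mathcal{H}$ the $\mathbb{K}$-vector space freely spanned by totally assigned graphs (TAGs), with product $m\big((\Gamma_1,\mu_1),(\Gamma_2,\mu_2)\big)=(\Gamma_1\sqcup\Gamma_2,\mu_1\sqcup\mu_2)$, unit $1_{\mathcal{H}}$ the empty graph, coproduct $\Delta\big((\Gamma,\mu)\big)=\sum_{\emptyset\subseteq(\gamma,\nu)\subseteq(\Gamma,\mu)}(\gamma,\nu)\otimes(\Gamma/\gamma,\mu/\nu)$ and counit $\epsilon$ with $\epsilon(1_{\mathcal{H}})=1$ and $\epsilon=0$ on all other TAGs. Then the bialgebra $(\mathcal{H},m,1_{\mathcal{H}},\Delta,\epsilon)$ is a Hopf algebra. Its antipode $S$ satisfies $S(1_{\mathcal{H}})=1_{\mathcal{H}}$ and, for any non-empty TAG $(\Gamma,\mu)$, $$S(\Gamma,\mu)=-(\Gamma,\mu)-\sum_{\emptyset\subsetneq(\gamma,\nu)\subsetneq(\Gamma,\mu)}S(\gamma,\nu)\cdot(\Gamma/\gamma,\mu/\nu)=-(\Gamma,\mu)-\sum_{\emptyset\subsetneq(\gamma,\nu)\subsetneq(\Gamma,\mu)}(\gamma,\nu)\cdot S(\Gamma/\gamma,\mu/\nu).$$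
   Context: Graphs are finite, possibly disconnected, with loops and multiple edges allowed; $E(\Gamma)$ is the edge set. A TAG is a pair $(\Gamma,\mu)$ where $\mu$ is a total order on $E(\Gamma)$. $\mu_1\sqcup\mu_2$ is the ordinal sum order: it restricts to $\mu_i$ on $E(\Gamma_i)$ and every edge of $\Gamma_1$ precedes every edge of $\Gamma_2$. A subgraph $\gamma$ of $\Gamma$ is formed by a subset of $E(\Gamma)$ together with the vertices incident to these edges; a totally assigned subgraph $(\gamma,\nu)$ carries $\nu=\mu|_{E(\gamma)}$. The shrinking $(\Gamma/\gamma,\mu/\nu)$: contract each connected component of $\gamma$ to a point, and restrict $\mu$ to the edges of $\Gamma$ not in $\gamma$. The product $\cdot$ is $m$.
   Formalization: Graphs are taken without isolated vertices, and isolated points produced by shrinking are discarded, so that Γ/Γ is the empty graph; otherwise the counit axiom fails, for example for a single loop. TAGs are taken up to order-preserving isomorphism. *)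

theory Defs
  imports Complex_Main "HOL-Library.Poly_Mapping" "HOL-Library.Uprod"
begin

section \<open>Totally assigned graphs\<close>

record ('v, 'e) graph =
  verts :: "'v set"
  edges :: "'e set"
  ends :: "'e \<Rightarrow> 'v uprod"
  eord :: "'e rel"

abbreviation incident :: "('v, 'e) graph \<Rightarrow> 'e set \<Rightarrow> 'v set" where
  "incident G A \<equiv> (\<Union>e\<in>A. set_uprod (ends G e))"

text \<open>There are no isolated vertices. A subgraph consists of edges and of the vertices incident
  to them, so this is what makes a graph a subgraph of itself; and the counit axiom needs
  \<open>\<Gamma>/\<Gamma>\<close>, which has only isolated vertices, to be the empty graph.\<close>

definition is_tag :: "('v, 'e) graph \<Rightarrow> bool" where
  "is_tag G \<longleftrightarrow> finite (verts G) \<and> finite (edges G) \<and> verts G = incident G (edges G) \<and>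
     linear_order_on (edges G) (eord G)"

definition graph_iso ::
  "('v, 'e) graph \<Rightarrow> ('w, 'f) graph \<Rightarrow> ('v \<Rightarrow> 'w) \<Rightarrow> ('e \<Rightarrow> 'f) \<Rightarrow> bool" where
  "graph_iso G H f g \<longleftrightarrow>
     bij_betw f (verts G) (verts H) \<and> bij_betw g (edges G) (edges H) \<and>
     (\<forall>e\<in>edges G. ends H (g e) = map_uprod f (ends G e)) \<and>
     (\<forall>e\<in>edges G. \<forall>e'\<in>edges G. (e, e') \<in> eord G \<longleftrightarrow> (g e, g e') \<in> eord H)"

definition tag_iso :: "('v, 'e) graph \<Rightarrow> ('w, 'f) graph \<Rightarrow> bool" where
  "tag_iso G H \<longleftrightarrow> is_tag G \<and> is_tag H \<and> (\<exists>f g. graph_iso G H f g)"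

definition empty_graph :: "('v, 'e) graph" where
  "empty_graph = \<lparr>verts = {}, edges = {}, ends = undefined, eord = {}\<rparr>"

definition ordinal_sum :: "('v, 'e) graph \<Rightarrow> ('w, 'f) graph \<Rightarrow> ('v + 'w, 'e + 'f) graph" where
  "ordinal_sum G H =
     \<lparr>verts = verts G <+> verts H,
      edges = edges G <+> edges H,
      ends = case_sum (map_uprod Inl \<circ> ends G) (map_uprod Inr \<circ> ends H),
      eord = map_prod Inl Inl ` eord G \<union> map_prod Inr Inr ` eord H \<union>
             (Inl ` edges G) \<times> (Inr ` edges H)\<rparr>"

definition subgraph :: "('v, 'e) graph \<Rightarrow> 'e set \<Rightarrow> ('v, 'e) graph" where
  "subgraph G A =
     \<lparr>verts = incident G A, edges = A, ends = ends G, eord = Restr (eord G) A\<rparr>"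

definition subgraphs :: "('v, 'e) graph \<Rightarrow> ('v, 'e) graph set" where
  "subgraphs G = subgraph G ` Pow (edges G)"

definition proper_subgraphs :: "('v, 'e) graph \<Rightarrow> ('v, 'e) graph set" where
  "proper_subgraphs G = {\<gamma> \<in> subgraphs G. edges \<gamma> \<noteq> {} \<and> edges \<gamma> \<noteq> edges G}"

definition adj :: "('v, 'e) graph \<Rightarrow> 'v rel" where
  "adj \<gamma> = {(v, w). \<exists>e\<in>edges \<gamma>. ends \<gamma> e = Upair v w}"

text \<open>The vertex set of the connected component of \<open>v\<close> in \<open>\<gamma>\<close>, or \<open>{v}\<close> if \<open>v\<close> is not a vertex
  of \<open>\<gamma>\<close>. These sets are the vertices of the shrinking.\<close>

definition component :: "('v, 'e) graph \<Rightarrow> 'v \<Rightarrow> 'v set" where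
  "component \<gamma> v = (adj \<gamma>)\<^sup>* `` {v}"

definition shrink :: "('v, 'e) graph \<Rightarrow> ('v, 'e) graph \<Rightarrow> ('v set, 'e) graph" where
  "shrink G \<gamma> =
     \<lparr>verts = component \<gamma> ` incident G (edges G - edges \<gamma>),
      edges = edges G - edges \<gamma>,
      ends = map_uprod (component \<gamma>) \<circ> ends G,
      eord = Restr (eord G) (edges G - edges \<gamma>)\<rparr>"


section \<open>Isomorphism classes\<close>

lemma incident_iso:
  assumes "graph_iso G H f g" "A \<subseteq> edges G"
  shows "incident H (g ` A) = f ` incident G A"
  using assms by (fastforce simp: graph_iso_def uprod.set_map subset_iff)

lemma graph_iso_refl: "graph_iso G G id id"
  by (simp add: graph_iso_def uprod.map_id)

lemma tag_isoD: "tag_iso G H \<Longrightarrow> is_tag G" "tag_iso G H \<Longrightarrow> is_tag H"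
  by (auto simp: tag_iso_def)

lemma tag_iso_refl: "is_tag G \<Longrightarrow> tag_iso G G"
  unfolding tag_iso_def using graph_iso_refl by blast

lemma tag_iso_trans:
  assumes "tag_iso G H" "tag_iso H K"
  shows "tag_iso G K"
proof -
  obtain f g f' g' where *: "graph_iso G H f g" "graph_iso H K f' g'"
    using assms unfolding tag_iso_def by blast
  have mem: "g e \<in> edges H" if "e \<in> edges G" for e
    using * that by (auto simp: graph_iso_def bij_betw_def)
  have "graph_iso G K (f' \<circ> f) (g' \<circ> g)"
    using * mem unfolding graph_iso_def
    by (auto intro: bij_betw_trans simp: uprod.map_comp)
  then show ?thesis using assms unfolding tag_iso_def by blast
qed

lemma ends_verts: "is_tag G \<Longrightarrow> e \<in> edges G \<Longrightarrow> set_uprod (ends G e) \<subseteq> verts G"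
  by (auto simp: is_tag_def)

lemma tag_iso_sym:
  assumes "tag_iso G H"
  shows "tag_iso H G"
proof -
  obtain f g where *: "graph_iso G H f g" and tags: "is_tag G" "is_tag H"
    using assms unfolding tag_iso_def by blast
  let ?f = "inv_into (verts G) f" and ?g = "inv_into (edges G) g"
  have f: "bij_betw f (verts G) (verts H)" and g: "bij_betw g (edges G) (edges H)"
    using * by (auto simp: graph_iso_def)
  have mem: "?g e \<in> edges G" "g (?g e) = e" if "e \<in> edges H" for e
    using g that by (auto simp: bij_betw_def inv_into_into f_inv_into_f)
  have "ends G (?g e) = map_uprod ?f (ends H e)" if e: "e \<in> edges H" for e
  proof -
    have "ends H e = map_uprod f (ends G (?g e))"
      using * mem[OF e] unfolding graph_iso_def by metis
    then have "map_uprod ?f (ends H e) = map_uprod (?f \<circ> f) (ends G (?g e))"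
      by (simp add: uprod.map_comp)
    also have "\<dots> = map_uprod id (ends G (?g e))"
      using f ends_verts[OF tags(1) mem(1)[OF e]]
      by (intro uprod.map_cong) (auto simp: bij_betw_def)
    finally show ?thesis by (simp add: uprod.map_id)
  qed
  moreover have "(e, e') \<in> eord H \<longleftrightarrow> (?g e, ?g e') \<in> eord G"
    if "e \<in> edges H" "e' \<in> edges H" for e e'
    using * mem that unfolding graph_iso_def by metis
  ultimately have "graph_iso H G ?f ?g"
    using f g by (auto simp: graph_iso_def bij_betw_inv_into)
  then show ?thesis using tags unfolding tag_iso_def by blast
qed

lemma is_tag_empty_graph: "is_tag empty_graph"
  by (simp add: is_tag_def empty_graph_def linear_order_on_def partial_order_on_def
      preorder_on_def refl_on_def)

quotient_type tag = "(nat, nat) graph" / partial: "tag_iso"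
proof (rule part_equivpI)
  show "\<exists>G :: (nat, nat) graph. tag_iso G G"
    using is_tag_empty_graph tag_iso_refl by blast
  show "symp (tag_iso :: (nat, nat) graph \<Rightarrow> _)"
    by (simp add: symp_def tag_iso_sym)
  show "transp (tag_iso :: (nat, nat) graph \<Rightarrow> _)"
    by (meson transpI tag_iso_trans)
qed

text \<open>The isomorphism class of a totally assigned graph, whatever its vertices and edges are made
  of; by finiteness it has a representative on natural numbers.\<close>

definition tag_of :: "('v, 'e) graph \<Rightarrow> tag" where
  "tag_of G = abs_tag (SOME H. tag_iso G H)"

lemma graph_iso_is_tag:
  assumes "is_tag G" "graph_iso G H f g" "eord H \<subseteq> edges H \<times> edges H"
  shows "is_tag H"
proof -
  have f: "bij_betw f (verts G) (verts H)" and g: "bij_betw g (edges G) (edges H)"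
    and ord: "\<And>e e'. e \<in> edges G \<Longrightarrow> e' \<in> edges G \<Longrightarrow>
      (e, e') \<in> eord G \<longleftrightarrow> (g e, g e') \<in> eord H"
    using assms by (auto simp: graph_iso_def)
  have im: "edges H = g ` edges G" "inj_on g (edges G)" using g by (auto simp: bij_betw_def)
  have lin: "refl_on (edges G) (eord G)" "trans (eord G)" "antisym (eord G)"
    "total_on (edges G) (eord G)" "eord G \<subseteq> edges G \<times> edges G"
    using assms(1) by (auto simp: is_tag_def order_on_defs)
  have mem: "x \<in> g ` edges G" "y \<in> g ` edges G" if "(x, y) \<in> eord H" for x y
    using assms(3) that by (auto simp: im(1))
  have "refl_on (edges H) (eord H)"
    using lin(1) ord im by (auto simp: refl_on_def)
  moreover have "trans (eord H)"
  proof (rule transI)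
    fix x y z assume xyz: "(x, y) \<in> eord H" "(y, z) \<in> eord H"
    then obtain a b c where abc: "a \<in> edges G" "b \<in> edges G" "c \<in> edges G"
      "x = g a" "y = g b" "z = g c"
      using mem by (metis imageE)
    then have "(a, b) \<in> eord G" "(b, c) \<in> eord G" using xyz ord by simp_all
    then have "(a, c) \<in> eord G" by (rule transD[OF lin(2)])
    then show "(x, z) \<in> eord H" using abc ord by simp
  qed
  moreover have "antisym (eord H)"
  proof (rule antisymI)
    fix x y assume xy: "(x, y) \<in> eord H" "(y, x) \<in> eord H"
    then obtain a b where ab: "a \<in> edges G" "b \<in> edges G" "x = g a" "y = g b"
      using mem by (metis imageE)
    then have "(a, b) \<in> eord G" "(b, a) \<in> eord G" using xy ord by simp_all
    then have "a = b" by (rule antisymD[OF lin(3)])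
    then show "x = y" using ab by simp
  qed
  moreover have "total_on (edges H) (eord H)"
    unfolding total_on_def
  proof (intro ballI impI)
    fix x y assume "x \<in> edges H" "y \<in> edges H" "x \<noteq> y"
    then obtain a b where "a \<in> edges G" "b \<in> edges G" "a \<noteq> b" "x = g a" "y = g b"
      by (auto simp: im(1))
    then show "(x, y) \<in> eord H \<or> (y, x) \<in> eord H"
      using lin(4) ord by (simp add: total_on_def)
  qed
  moreover have "verts H = incident H (edges H)"
    using incident_iso[OF assms(2) order_refl] assms(1) f im(1) by (auto simp: is_tag_def bij_betw_def)
  moreover have "finite (verts H)" "finite (edges H)"
    using assms(1) f g by (auto simp: is_tag_def bij_betw_finite)
  ultimately show ?thesis using assms(3) by (auto simp: is_tag_def order_on_defs)
qed

lemma ex_nat_graph: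
  assumes "is_tag G"
  shows "\<exists>H :: (nat, nat) graph. tag_iso G H"
proof -
  obtain f g :: "_ \<Rightarrow> nat" where f: "inj_on f (verts G)" and g: "inj_on g (edges G)"
    using assms finite_imp_inj_to_nat_seg unfolding is_tag_def by metis
  define H where "H = \<lparr>verts = f ` verts G, edges = g ` edges G,
    ends = (\<lambda>n. map_uprod f (ends G (inv_into (edges G) g n))), eord = map_prod g g ` eord G\<rparr>"
  have sub: "eord G \<subseteq> edges G \<times> edges G" using assms by (auto simp: is_tag_def order_on_defs)
  have "(e, e') \<in> eord G \<longleftrightarrow> (g e, g e') \<in> eord H" if "e \<in> edges G" "e' \<in> edges G" for e e'
  proof
    assume "(g e, g e') \<in> eord H"
    then obtain a b where "(a, b) \<in> eord G" "g a = g e" "g b = g e'"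
      by (auto simp: H_def)
    moreover from this have "a = e" "b = e'"
      using that sub inj_onD[OF g] by blast+
    ultimately show "(e, e') \<in> eord G" by simp
  qed (force simp: H_def)
  then have iso: "graph_iso G H f g"
    using f g by (auto simp: graph_iso_def H_def bij_betw_def)
  moreover have "is_tag H"
    using sub by (intro graph_iso_is_tag[OF assms iso]) (auto simp: H_def)
  ultimately show ?thesis using assms unfolding tag_iso_def by blast
qed

lemma abs_tag_eq_iff:
  "is_tag G \<Longrightarrow> is_tag H \<Longrightarrow> abs_tag G = abs_tag H \<longleftrightarrow> tag_iso G H"
  using Quotient3_rel[OF Quotient3_tag, of G H] tag_iso_refl by blast

lemma tag_of_eq_iff:
  fixes G :: "('v, 'e) graph" and H :: "('w, 'f) graph"
  assumes "is_tag G" "is_tag H"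
  shows "tag_of G = tag_of H \<longleftrightarrow> tag_iso G H"
proof -
  let ?G = "SOME K :: (nat, nat) graph. tag_iso G K"
  let ?H = "SOME K :: (nat, nat) graph. tag_iso H K"
  have G: "tag_iso G ?G" and H: "tag_iso H ?H"
    using assms ex_nat_graph by (metis someI_ex)+
  have "is_tag ?G" "is_tag ?H" using tag_isoD(2)[OF G] tag_isoD(2)[OF H] by simp_all
  then have "tag_of G = tag_of H \<longleftrightarrow> tag_iso ?G ?H"
    unfolding tag_of_def by (rule abs_tag_eq_iff)
  also have "\<dots> \<longleftrightarrow> tag_iso G H"
  proof
    assume "tag_iso ?G ?H"
    then show "tag_iso G H"
      by (rule tag_iso_trans[OF G tag_iso_trans[OF _ tag_iso_sym[OF H]]])
  next
    assume "tag_iso G H"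
    then show "tag_iso ?G ?H"
      by (rule tag_iso_trans[OF tag_iso_sym[OF G] tag_iso_trans[OF _ H]])
  qed
  finally show ?thesis .
qed

lemma tag_of_eqI: "tag_iso G H \<Longrightarrow> tag_of G = tag_of H"
  by (simp add: tag_of_eq_iff tag_isoD)

lemma is_tag_rep_tag: "is_tag (rep_tag t)"
  using Quotient3_rep_reflp[OF Quotient3_tag] by (auto simp: tag_iso_def)

lemma tag_of_rep_tag: "tag_of (rep_tag t) = t"
proof -
  let ?K = "SOME K :: (nat, nat) graph. tag_iso (rep_tag t) K"
  have "tag_iso (rep_tag t) ?K"
    using ex_nat_graph[OF is_tag_rep_tag] by (rule someI_ex)
  then have "abs_tag (rep_tag t) = abs_tag ?K"
    using abs_tag_eq_iff tag_isoD by blast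
  then show ?thesis
    by (simp add: tag_of_def Quotient3_abs_rep[OF Quotient3_tag])
qed

lemma tag_iso_rep_tag:
  assumes "is_tag G" shows "tag_iso G (rep_tag (tag_of G))"
  using tag_of_eq_iff[OF assms is_tag_rep_tag, of "tag_of G"] by (simp add: tag_of_rep_tag)

lemma linear_order_on_Restr:
  "linear_order_on A r \<Longrightarrow> B \<subseteq> A \<Longrightarrow> linear_order_on B (Restr r B)"
  unfolding order_on_defs by (auto simp: refl_on_def total_on_def subset_iff
    intro: trans_Restr antisym_subset)

lemma is_tag_subgraph: "is_tag G \<Longrightarrow> A \<subseteq> edges G \<Longrightarrow> is_tag (subgraph G A)"
  by (auto simp: is_tag_def subgraph_def linear_order_on_Restr intro: finite_subset)

lemma inj_on_subgraph: "inj_on (subgraph G) X"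
  by (auto simp: inj_on_def subgraph_def)

lemma is_tag_shrink: "is_tag G \<Longrightarrow> is_tag (shrink G \<gamma>)"
  by (auto simp: is_tag_def shrink_def linear_order_on_Restr uprod.set_map)

lemma ordinal_sum_simps [simp]:
  "verts (ordinal_sum G H) = verts G <+> verts H"
  "edges (ordinal_sum G H) = edges G <+> edges H"
  "ends (ordinal_sum G H) (Inl e) = map_uprod Inl (ends G e)"
  "ends (ordinal_sum G H) (Inr e') = map_uprod Inr (ends H e')"
  "(Inl e, Inl e1) \<in> eord (ordinal_sum G H) \<longleftrightarrow> (e, e1) \<in> eord G"
  "(Inr e', Inr e1') \<in> eord (ordinal_sum G H) \<longleftrightarrow> (e', e1') \<in> eord H"
  "(Inl e, Inr e') \<in> eord (ordinal_sum G H) \<longleftrightarrow> e \<in> edges G \<and> e' \<in> edges H"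
  "(Inr e', Inl e) \<notin> eord (ordinal_sum G H)"
  by (auto simp: ordinal_sum_def)

lemma is_tag_ordinal_sum:
  assumes "is_tag G" "is_tag H"
  shows "is_tag (ordinal_sum G H)"
proof -
  let ?r = "eord (ordinal_sum G H)" and ?E = "edges G <+> edges H"
  have 1: "refl_on (edges G) (eord G)" "trans (eord G)" "antisym (eord G)"
    "total_on (edges G) (eord G)" "eord G \<subseteq> edges G \<times> edges G"
    "refl_on (edges H) (eord H)" "trans (eord H)" "antisym (eord H)"
    "total_on (edges H) (eord H)" "eord H \<subseteq> edges H \<times> edges H"
    using assms by (auto simp: is_tag_def order_on_defs)
  have mem: "e \<in> edges G" "e1 \<in> edges G" if "(e, e1) \<in> eord G" for e e1 using 1(5) that by auto
  have mem': "e \<in> edges H" "e1 \<in> edges H" if "(e, e1) \<in> eord H" for e e1 using 1(10) that by auto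
  have "refl_on ?E ?r"
    using 1(1,6) by (auto simp: refl_on_def)
  moreover have "total_on ?E ?r"
    using 1(4,9) unfolding total_on_def by (auto; blast)
  moreover have "?r \<subseteq> ?E \<times> ?E"
  proof
    fix p assume "p \<in> ?r"
    then show "p \<in> ?E \<times> ?E"
      by (cases p rule: prod.exhaust, cases "fst p"; cases "snd p") (auto dest: mem mem')
  qed
  moreover have "antisym ?r"
  proof (rule antisymI)
    fix x y assume "(x, y) \<in> ?r" "(y, x) \<in> ?r"
    then show "x = y"
      by (cases x; cases y) (auto dest: antisymD[OF 1(3)] antisymD[OF 1(8)])
  qed
  moreover have "trans ?r"
  proof (rule transI)
    fix x y z assume "(x, y) \<in> ?r" "(y, z) \<in> ?r"
    then show "(x, z) \<in> ?r"
      by (cases x; cases y; cases z) (auto dest: mem mem' intro: transD[OF 1(2)] transD[OF 1(7)])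
  qed
  ultimately have "linear_order_on ?E ?r" by (simp add: order_on_defs)
  moreover have "verts G <+> verts H = incident (ordinal_sum G H) ?E"
    using assms by (auto simp: is_tag_def uprod.set_map)
  ultimately show ?thesis
    using assms by (simp add: is_tag_def)
qed

lemma tag_iso_ordinal_sum:
  assumes "tag_iso G G'" "tag_iso H H'"
  shows "tag_iso (ordinal_sum G H) (ordinal_sum G' H')"
proof -
  obtain f g f' g' where *: "graph_iso G G' f g" "graph_iso H H' f' g'"
    using assms unfolding tag_iso_def by blast
  have bij: "bij_betw (map_sum a b) (A <+> B) (C <+> D)"
    if "bij_betw a A C" "bij_betw b B D" for a b A B C D
  proof (rule bij_betw_imageI)
    show "inj_on (map_sum a b) (A <+> B)"
      using that unfolding bij_betw_def by (intro inj_onI) (auto dest: inj_onD)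
    have "map_sum a b ` (A <+> B) = a ` A <+> b ` B"
      by (auto simp: Plus_def image_Un image_image)
    then show "map_sum a b ` (A <+> B) = C <+> D"
      using that by (simp add: bij_betw_def)
  qed
  have mem: "e \<in> edges G \<Longrightarrow> g e \<in> edges G'" "e' \<in> edges H \<Longrightarrow> g' e' \<in> edges H'" for e e'
    using * by (auto simp: graph_iso_def bij_betw_def)
  have "graph_iso (ordinal_sum G H) (ordinal_sum G' H') (map_sum f f') (map_sum g g')"
    unfolding graph_iso_def
  proof (intro conjI ballI)
    fix e assume "e \<in> edges (ordinal_sum G H)"
    then show "ends (ordinal_sum G' H') (map_sum g g' e) =
        map_uprod (map_sum f f') (ends (ordinal_sum G H) e)"
      using * by (cases e) (auto simp: graph_iso_def uprod.map_comp comp_def)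
  next
    fix e e1 assume "e \<in> edges (ordinal_sum G H)" "e1 \<in> edges (ordinal_sum G H)"
    then show "(e, e1) \<in> eord (ordinal_sum G H) \<longleftrightarrow>
        (map_sum g g' e, map_sum g g' e1) \<in> eord (ordinal_sum G' H')"
      using * mem by (cases e; cases e1) (auto simp: graph_iso_def)
  qed (use * in \<open>auto simp: graph_iso_def intro: bij\<close>)
  moreover have "is_tag (ordinal_sum G H)" "is_tag (ordinal_sum G' H')"
    using assms by (simp_all add: is_tag_ordinal_sum tag_isoD)
  ultimately show ?thesis unfolding tag_iso_def by blast
qed

lemma graph_iso_subgraph:
  assumes "graph_iso G H f g" "is_tag G" "A \<subseteq> edges G"
  shows "graph_iso (subgraph G A) (subgraph H (g ` A)) f g"
proof -
  have "incident G A \<subseteq> verts G" using assms(2,3) by (auto simp: is_tag_def)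
  then have "bij_betw f (incident G A) (incident H (g ` A))"
    using assms incident_iso[OF assms(1,3)]
    by (auto simp: graph_iso_def bij_betw_def intro: inj_on_subset)
  moreover have "bij_betw g A (g ` A)"
    using assms by (auto simp: graph_iso_def bij_betw_def intro: inj_on_subset)
  moreover have "\<forall>e\<in>A. ends H (g e) = map_uprod f (ends G e)"
    "\<forall>e\<in>A. \<forall>e'\<in>A. (e, e') \<in> eord G \<longleftrightarrow> (g e, g e') \<in> eord H"
    using assms by (auto simp: graph_iso_def subset_iff)
  ultimately show ?thesis by (simp add: graph_iso_def subgraph_def)
qed

lemma component_iso:
  assumes "graph_iso G H f g" "is_tag G" "A \<subseteq> edges G" "v \<in> verts G"
  shows "component (subgraph H (g ` A)) (f v) = f ` component (subgraph G A) v"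
    and "component (subgraph G A) v \<subseteq> verts G"
proof -
  let ?r = "adj (subgraph G A)" and ?s = "adj (subgraph H (g ` A))"
  have inj: "inj_on f (verts G)" and e: "\<And>e. e \<in> A \<Longrightarrow> ends H (g e) = map_uprod f (ends G e)"
    using assms(1,3) by (auto simp: graph_iso_def bij_betw_def)
  have r: "v \<in> verts G \<and> w \<in> verts G \<and> (f v, f w) \<in> ?s" if "(v, w) \<in> ?r" for v w
  proof -
    obtain a where a: "a \<in> A" "ends G a = Upair v w"
      using \<open>(v, w) \<in> ?r\<close> by (auto simp: adj_def subgraph_def)
    then have "ends H (g a) = Upair (f v) (f w)" using e by simp
    moreover have "{v, w} \<subseteq> verts G"
      using ends_verts[OF assms(2), of a] a assms(3) by auto
    ultimately show ?thesis using a by (auto simp: adj_def subgraph_def)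
  qed
  have s: "\<exists>w\<in>verts G. y = f w \<and> (v, w) \<in> ?r" if "(f v, y) \<in> ?s" "v \<in> verts G" for v y
  proof -
    obtain a where a: "a \<in> A" "ends H (g a) = Upair (f v) y"
      using \<open>(f v, y) \<in> ?s\<close> by (auto simp: adj_def subgraph_def)
    obtain p q where pq: "ends G a = Upair p q" by (cases "ends G a")
    then have "p \<in> verts G" "q \<in> verts G"
      using ends_verts[OF assms(2), of a] a assms(3) by auto
    moreover have "Upair (f p) (f q) = Upair (f v) y" using a e pq by simp
    moreover have "(p, q) \<in> ?r" "(q, p) \<in> ?r"
      using a pq by (auto simp: adj_def subgraph_def intro!: bexI[of _ a])
    ultimately show ?thesis
      using inj \<open>v \<in> verts G\<close> by (auto dest: inj_onD)
  qed
  have 1: "w \<in> verts G \<and> (f v, f w) \<in> ?s\<^sup>*" if "(v, w) \<in> ?r\<^sup>*" for w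
    using that by induction (use assms(4) r in \<open>auto intro: rtrancl_into_rtrancl\<close>)
  have 2: "\<exists>w\<in>verts G. y = f w \<and> (v, w) \<in> ?r\<^sup>*" if "(f v, y) \<in> ?s\<^sup>*" for y
    using that
  proof induction
    case (step y z)
    then show ?case using s by (metis rtrancl_into_rtrancl)
  qed (use assms(4) in auto)
  show "component (subgraph H (g ` A)) (f v) = f ` component (subgraph G A) v"
    using 1 2 unfolding component_def by blast
  show "component (subgraph G A) v \<subseteq> verts G"
    using 1 by (auto simp: component_def)
qed

lemma graph_iso_shrink:
  assumes "graph_iso G H f g" "is_tag G" "is_tag H" "A \<subseteq> edges G"
  shows "graph_iso (shrink G (subgraph G A)) (shrink H (subgraph H (g ` A))) (image f) g"
proof -
  let ?c = "component (subgraph G A)" and ?d = "component (subgraph H (g ` A))"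
  let ?B = "edges G - A"
  have f: "bij_betw f (verts G) (verts H)" and g: "bij_betw g (edges G) (edges H)"
    using assms(1) by (auto simp: graph_iso_def)
  have B: "edges H - g ` A = g ` ?B"
    using g assms(4) by (auto simp: bij_betw_def inj_on_def) blast
  have inc: "incident G ?B \<subseteq> verts G" using assms(2) by (auto simp: is_tag_def)
  have c: "?d (f v) = f ` ?c v" "?c v \<subseteq> verts G" if "v \<in> verts G" for v
    using component_iso[OF assms(1,2,4) that] by auto
  have "?d ` incident H (g ` ?B) = image f ` ?c ` incident G ?B"
    using incident_iso[OF assms(1), of ?B] inc c by (auto simp: image_image subset_iff)
  moreover have "inj_on (image f) (?c ` incident G ?B)"
    using f inc c(2) by (intro inj_on_subset[OF inj_on_image_Pow[of f "verts G"]])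
      (auto simp: bij_betw_def)
  ultimately have "bij_betw (image f) (?c ` incident G ?B) (?d ` incident H (g ` ?B))"
    by (simp add: bij_betw_def)
  moreover have "bij_betw g ?B (g ` ?B)"
    using g by (auto simp: bij_betw_def intro: inj_on_subset)
  moreover have "map_uprod ?d (ends H (g e)) = map_uprod (image f) (map_uprod ?c (ends G e))"
    if "e \<in> ?B" for e
  proof -
    have "ends H (g e) = map_uprod f (ends G e)"
      using assms(1) that by (auto simp: graph_iso_def)
    then have "map_uprod ?d (ends H (g e)) = map_uprod (?d \<circ> f) (ends G e)"
      by (simp add: uprod.map_comp)
    also have "\<dots> = map_uprod (image f \<circ> ?c) (ends G e)"
      using ends_verts[OF assms(2), of e] that c(1) by (intro uprod.map_cong) auto
    finally show ?thesis by (simp add: uprod.map_comp)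
  qed
  moreover have "\<forall>e\<in>?B. \<forall>e'\<in>?B. (e, e') \<in> eord G \<longleftrightarrow> (g e, g e') \<in> eord H"
    using assms(1) by (auto simp: graph_iso_def)
  ultimately show ?thesis
    unfolding B[symmetric] by (auto simp: graph_iso_def shrink_def subgraph_def B)
qed


section \<open>Hopf algebras on a vector space with a basis\<close>

text \<open>The vector space freely spanned by \<open>'b\<close> is \<open>'b \<Rightarrow>\<^sub>0 'k\<close>, and the tensor product of two such
  spaces is the space freely spanned by the pairs of basis elements.\<close>

definition scale :: "'k::field \<Rightarrow> ('b \<Rightarrow>\<^sub>0 'k) \<Rightarrow> ('b \<Rightarrow>\<^sub>0 'k)" where
  "scale c = Poly_Mapping.map ((*) c)"

abbreviation basis :: "'b \<Rightarrow> ('b \<Rightarrow>\<^sub>0 'k::field)" where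
  "basis b \<equiv> Poly_Mapping.single b 1"

definition lin_ext :: "('b \<Rightarrow> ('c \<Rightarrow>\<^sub>0 'k)) \<Rightarrow> ('b \<Rightarrow>\<^sub>0 'k::field) \<Rightarrow> ('c \<Rightarrow>\<^sub>0 'k)" where
  "lin_ext f x = (\<Sum>b\<in>Poly_Mapping.keys x. scale (Poly_Mapping.lookup x b) (f b))"

definition tensor :: "('b \<Rightarrow>\<^sub>0 'k) \<Rightarrow> ('c \<Rightarrow>\<^sub>0 'k) \<Rightarrow> ('b \<times> 'c \<Rightarrow>\<^sub>0 'k::field)" (infixr \<open>\<otimes>\<close> 75) where
  "x \<otimes> y = lin_ext (\<lambda>b. lin_ext (\<lambda>c. basis (b, c)) y) x"

lemma scale_one: "scale 1 x = x"
  unfolding scale_def by (intro poly_mapping_eqI) (simp add: Poly_Mapping.map.rep_eq when_def)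

lemma lookup_scale: "Poly_Mapping.lookup (scale c x) b = c * Poly_Mapping.lookup x b"
  by (simp add: scale_def Poly_Mapping.map.rep_eq when_def)

lemma vector_space_scale: "vector_space (scale :: 'k::field \<Rightarrow> ('b \<Rightarrow>\<^sub>0 'k) \<Rightarrow> _)"
  by unfold_locales (auto intro!: poly_mapping_eqI simp: lookup_scale lookup_add algebra_simps)

lemma lin_ext_basis: "lin_ext f (basis b) = f b"
  by (simp add: lin_ext_def scale_one)

lemma tensor_basis: "basis b \<otimes> basis c = basis (b, c)"
  by (simp add: tensor_def lin_ext_basis)

definition tensor_map ::
  "(('b \<Rightarrow>\<^sub>0 'k) \<Rightarrow> ('d \<Rightarrow>\<^sub>0 'k)) \<Rightarrow> (('c \<Rightarrow>\<^sub>0 'k) \<Rightarrow> ('e \<Rightarrow>\<^sub>0 'k)) \<Rightarrow>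
   ('b \<times> 'c \<Rightarrow>\<^sub>0 'k::field) \<Rightarrow> ('d \<times> 'e \<Rightarrow>\<^sub>0 'k)" where
  "tensor_map f g = lin_ext (\<lambda>(b, c). f (basis b) \<otimes> g (basis c))"

definition tensor_assoc :: "(('b \<times> 'c) \<times> 'd \<Rightarrow>\<^sub>0 'k::field) \<Rightarrow> ('b \<times> 'c \<times> 'd \<Rightarrow>\<^sub>0 'k)" where
  "tensor_assoc = lin_ext (\<lambda>((b, c), d). basis (b, c, d))"

definition middle_swap ::
  "(('b \<times> 'c) \<times> ('d \<times> 'e) \<Rightarrow>\<^sub>0 'k::field) \<Rightarrow> (('b \<times> 'd) \<times> ('c \<times> 'e) \<Rightarrow>\<^sub>0 'k)" where
  "middle_swap = lin_ext (\<lambda>((b, c), (d, e)). basis ((b, d), (c, e)))"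

definition counit_left :: "(('b \<Rightarrow>\<^sub>0 'k) \<Rightarrow> 'k) \<Rightarrow> ('b \<times> 'c \<Rightarrow>\<^sub>0 'k::field) \<Rightarrow> ('c \<Rightarrow>\<^sub>0 'k)" where
  "counit_left \<epsilon> = lin_ext (\<lambda>(b, c). scale (\<epsilon> (basis b)) (basis c))"

definition counit_right :: "(('c \<Rightarrow>\<^sub>0 'k) \<Rightarrow> 'k) \<Rightarrow> ('b \<times> 'c \<Rightarrow>\<^sub>0 'k::field) \<Rightarrow> ('b \<Rightarrow>\<^sub>0 'k)" where
  "counit_right \<epsilon> = lin_ext (\<lambda>(b, c). scale (\<epsilon> (basis c)) (basis b))"

locale unital_algebra =
  fixes m :: "('b \<times> 'b \<Rightarrow>\<^sub>0 'k::field) \<Rightarrow> ('b \<Rightarrow>\<^sub>0 'k)"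
    and u :: "'b \<Rightarrow>\<^sub>0 'k"
  assumes linear_m: "Vector_Spaces.linear scale scale m"
    and m_assoc: "m (tensor_map m id x) = m (tensor_map id m (tensor_assoc x))"
    and m_unit_left: "m (u \<otimes> y) = y"
    and m_unit_right: "m (y \<otimes> u) = y"

locale counital_coalgebra =
  fixes \<Delta> :: "('b \<Rightarrow>\<^sub>0 'k::field) \<Rightarrow> ('b \<times> 'b \<Rightarrow>\<^sub>0 'k)"
    and \<epsilon> :: "('b \<Rightarrow>\<^sub>0 'k) \<Rightarrow> 'k"
  assumes linear_\<Delta>: "Vector_Spaces.linear scale scale \<Delta>"
    and linear_\<epsilon>: "Vector_Spaces.linear scale (*) \<epsilon>"
    and coassoc: "tensor_assoc (tensor_map \<Delta> id (\<Delta> x)) = tensor_map id \<Delta> (\<Delta> x)"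
    and counit_law_left: "counit_left \<epsilon> (\<Delta> x) = x"
    and counit_law_right: "counit_right \<epsilon> (\<Delta> x) = x"

locale bialgebra = unital_algebra m u + counital_coalgebra \<Delta> \<epsilon>
  for m :: "('b \<times> 'b \<Rightarrow>\<^sub>0 'k::field) \<Rightarrow> ('b \<Rightarrow>\<^sub>0 'k)" and u and \<Delta> and \<epsilon> +
  assumes \<Delta>_mult: "\<Delta> (m (x \<otimes> y)) = tensor_map m m (middle_swap (\<Delta> x \<otimes> \<Delta> y))"
    and \<Delta>_unit: "\<Delta> u = u \<otimes> u"
    and \<epsilon>_mult: "\<epsilon> (m (x \<otimes> y)) = \<epsilon> x * \<epsilon> y"
    and \<epsilon>_unit: "\<epsilon> u = 1"

definition is_antipode ::
  "(('b \<times> 'b \<Rightarrow>\<^sub>0 'k::field) \<Rightarrow> ('b \<Rightarrow>\<^sub>0 'k)) \<Rightarrow> ('b \<Rightarrow>\<^sub>0 'k) \<Rightarrow>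
   (('b \<Rightarrow>\<^sub>0 'k) \<Rightarrow> ('b \<times> 'b \<Rightarrow>\<^sub>0 'k)) \<Rightarrow> (('b \<Rightarrow>\<^sub>0 'k) \<Rightarrow> 'k) \<Rightarrow>
   (('b \<Rightarrow>\<^sub>0 'k) \<Rightarrow> ('b \<Rightarrow>\<^sub>0 'k)) \<Rightarrow> bool" where
  "is_antipode m u \<Delta> \<epsilon> S \<longleftrightarrow> Vector_Spaces.linear scale scale S \<and>
     (\<forall>x. m (tensor_map S id (\<Delta> x)) = scale (\<epsilon> x) u \<and>
          m (tensor_map id S (\<Delta> x)) = scale (\<epsilon> x) u)"

locale hopf_algebra = bialgebra m u \<Delta> \<epsilon>
  for m :: "('b \<times> 'b \<Rightarrow>\<^sub>0 'k::field) \<Rightarrow> ('b \<Rightarrow>\<^sub>0 'k)" and u and \<Delta> and \<epsilon> +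
  assumes ex_antipode: "\<exists>S. is_antipode m u \<Delta> \<epsilon> S"


section \<open>The Hopf algebra of totally assigned graphs\<close>

type_synonym 'k tag_space = "tag \<Rightarrow>\<^sub>0 'k"

abbreviation tag_vec :: "('v, 'e) graph \<Rightarrow> 'k::field tag_space" where
  "tag_vec G \<equiv> basis (tag_of G)"

definition tag_mult :: "(tag \<times> tag \<Rightarrow>\<^sub>0 'k::field) \<Rightarrow> 'k tag_space" where
  "tag_mult = lin_ext (\<lambda>(s, t). tag_vec (ordinal_sum (rep_tag s) (rep_tag t)))"

definition tag_unit :: "'k::field tag_space" where
  "tag_unit = tag_vec (empty_graph :: (nat, nat) graph)"

definition tag_comult :: "'k::field tag_space \<Rightarrow> (tag \<times> tag \<Rightarrow>\<^sub>0 'k)" where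
  "tag_comult = lin_ext (\<lambda>t. \<Sum>\<gamma>\<in>subgraphs (rep_tag t). tag_vec \<gamma> \<otimes> tag_vec (shrink (rep_tag t) \<gamma>))"

text \<open>The linear form that is 1 on the empty graph and 0 on all other isomorphism classes.\<close>

definition tag_counit :: "'k::field tag_space \<Rightarrow> 'k" where
  "tag_counit x = Poly_Mapping.lookup x (tag_of (empty_graph :: (nat, nat) graph))"

abbreviation tag_times :: "'k::field tag_space \<Rightarrow> 'k tag_space \<Rightarrow> 'k tag_space"
  (infixl \<open>\<cdot>\<close> 70) where
  "x \<cdot> y \<equiv> tag_mult (x \<otimes> y)"

text \<open>The structure maps do not depend on the choice of representatives.\<close>

lemma tag_mult_tag_vec:
  assumes "is_tag G" "is_tag H"
  shows "tag_vec G \<cdot> tag_vec H = tag_vec (ordinal_sum G H)"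
proof -
  have "tag_iso (ordinal_sum G H) (ordinal_sum (rep_tag (tag_of G)) (rep_tag (tag_of H)))"
    using assms by (intro tag_iso_ordinal_sum tag_iso_rep_tag)
  then have "tag_of (ordinal_sum (rep_tag (tag_of G)) (rep_tag (tag_of H))) = tag_of (ordinal_sum G H)"
    by (simp add: tag_of_eqI)
  then show ?thesis by (simp add: tag_mult_def tensor_basis lin_ext_basis)
qed

lemma tag_comult_tag_vec:
  assumes "is_tag G"
  shows "tag_comult (tag_vec G) = (\<Sum>\<gamma>\<in>subgraphs G. tag_vec \<gamma> \<otimes> tag_vec (shrink G \<gamma>))"
proof -
  let ?H = "rep_tag (tag_of G)"
  obtain f g where iso: "graph_iso G ?H f g" and H: "is_tag ?H"
    using tag_iso_rep_tag[OF assms] unfolding tag_iso_def by blast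
  have bij: "bij_betw (image g) (Pow (edges G)) (Pow (edges ?H))"
    using iso by (auto simp: graph_iso_def intro: bij_betw_Pow)
  have eq: "tag_of (subgraph G A) = tag_of (subgraph ?H (g ` A))"
    "tag_of (shrink G (subgraph G A)) = tag_of (shrink ?H (subgraph ?H (g ` A)))"
    if A: "A \<subseteq> edges G" for A
  proof -
    have gA: "g ` A \<subseteq> edges ?H" using iso image_mono[OF A, of g] by (simp add: graph_iso_def bij_betw_def)
    have "tag_iso (subgraph G A) (subgraph ?H (g ` A))"
      using graph_iso_subgraph[OF iso assms A] is_tag_subgraph[OF assms A] is_tag_subgraph[OF H gA]
      unfolding tag_iso_def by blast
    then show "tag_of (subgraph G A) = tag_of (subgraph ?H (g ` A))"
      by (simp add: tag_of_eqI)
    have "tag_iso (shrink G (subgraph G A)) (shrink ?H (subgraph ?H (g ` A)))"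
      using graph_iso_shrink[OF iso assms H A] is_tag_shrink[OF assms] is_tag_shrink[OF H]
      unfolding tag_iso_def by blast
    then show "tag_of (shrink G (subgraph G A)) = tag_of (shrink ?H (subgraph ?H (g ` A)))"
      by (simp add: tag_of_eqI)
  qed
  have "tag_comult (tag_vec G) =
      (\<Sum>\<gamma>\<in>subgraphs ?H. tag_vec \<gamma> \<otimes> tag_vec (shrink ?H \<gamma>))"
    by (simp add: tag_comult_def lin_ext_basis)
  also have "\<dots> = (\<Sum>B\<in>Pow (edges ?H).
      tag_vec (subgraph ?H B) \<otimes> tag_vec (shrink ?H (subgraph ?H B)))"
    unfolding subgraphs_def by (subst sum.reindex[OF inj_on_subgraph]) (simp add: comp_def)
  also have "\<dots> = (\<Sum>A\<in>Pow (edges G).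
      tag_vec (subgraph ?H (g ` A)) \<otimes> tag_vec (shrink ?H (subgraph ?H (g ` A))))"
    by (rule sum.reindex_bij_betw[OF bij, symmetric])
  also have "\<dots> = (\<Sum>A\<in>Pow (edges G).
      tag_vec (subgraph G A) \<otimes> tag_vec (shrink G (subgraph G A)))"
    using eq by (intro sum.cong) auto
  also have "\<dots> = (\<Sum>\<gamma>\<in>subgraphs G. tag_vec \<gamma> \<otimes> tag_vec (shrink G \<gamma>))"
    unfolding subgraphs_def by (subst sum.reindex[OF inj_on_subgraph]) (simp add: comp_def)
  finally show ?thesis .
qed

end

(* Coassociativity: a flag B <= A of edge sets of G corresponds to the pair (B, A - B) of an edge set of
   G and one of G/B, under which A/B = (A - B) as a subgraph of G/B, and G/A is isomorphic to
   (G/B)/(A - B).  Antipode: the graph itself occurs in each half of the coproduct only next to the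
   empty graph, so the equations S * id = unit counit and id * S = unit counit for the convolution
   product can each be solved recursively on the number of edges; a left and a right inverse in the
   convolution monoid coincide.  Isolating the two extreme summands in the antipode equations gives
   the two formulas for S. *)
theory Submission
  imports Defs
begin

section \<open>Linear algebra on bases\<close>

text \<open>The number of edges can drive the recursion because the edgeless graphs form a single
  class: a TAG has no isolated vertices, so the empty subgraph and the full quotient
  \<open>G/G\<close> both represent the unit, and an extreme summand of the coproduct is multiplied
  by the unit only. The product depends on the order of its factors, since the ordinal sum puts the
  edges of the first factor first. Hence the recursion through subgraphs and the one through
  quotients are not exchanged by a symmetry, and both inverses are built separately. Most of the
  work goes into the combinatorics of classes. A basis vector is an isomorphism class, and
  contraction changes the vertex type: the vertices of \<open>G/B\<close> are sets of vertices,
  those of an iterated quotient are sets of such sets. Identities between graphs of different types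
  therefore rest on explicit isomorphisms. Sums over subgraphs are indexed by edge sets, so that the
  bijections between index sets become plain set operations.\<close>

abbreviation linear_map :: "(('b \<Rightarrow>\<^sub>0 'k::field) \<Rightarrow> ('c \<Rightarrow>\<^sub>0 'k)) \<Rightarrow> bool" where
  "linear_map \<equiv> Vector_Spaces.linear scale scale"

lemma linear_mapI:
  fixes f :: "('b \<Rightarrow>\<^sub>0 'k::field) \<Rightarrow> ('c \<Rightarrow>\<^sub>0 'k)"
  assumes "\<And>x y. f (x + y) = f x + f y" "\<And>c x. f (scale c x) = scale c (f x)"
  shows "linear_map f"
proof -
  interpret V: vector_space "scale :: 'k \<Rightarrow> ('b \<Rightarrow>\<^sub>0 'k) \<Rightarrow> _" by (rule vector_space_scale)
  interpret W: vector_space "scale :: 'k \<Rightarrow> ('c \<Rightarrow>\<^sub>0 'k) \<Rightarrow> _" by (rule vector_space_scale)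
  show ?thesis using assms by unfold_locales auto
qed

lemma linear_map_module_hom: "linear_map f \<Longrightarrow> module_hom scale scale f"
  by (simp add: linear_iff_module_hom)

lemmas linear_map_add = module_hom.add[OF linear_map_module_hom]
  and linear_map_scale = module_hom.scale[OF linear_map_module_hom]
  and linear_map_sum = module_hom.sum[OF linear_map_module_hom]

lemma scale_simps:
  fixes x y :: "'b \<Rightarrow>\<^sub>0 'k::field"
  shows
  "scale c (x + y) = scale c x + scale c y"
  "scale (c + d) x = scale c x + scale d x"
  "scale c (scale d x) = scale (c * d) x"
  "scale 0 x = 0" "scale 1 x = x" "scale c 0 = 0"
  by (auto intro!: poly_mapping_eqI simp: lookup_scale lookup_add algebra_simps)

lemma poly_mapping_eq_sum_basis:
  "x = (\<Sum>b\<in>Poly_Mapping.keys x. scale (Poly_Mapping.lookup x b) (basis b))"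
  by (intro poly_mapping_eqI)
    (simp add: lookup_sum lookup_scale lookup_single when_def if_distrib sum.delta in_keys_iff cong: if_cong)

lemma linear_map_eqI:
  assumes "linear_map f" "linear_map g" "\<And>b. f (basis b) = g (basis b)"
  shows "f x = g x"
  by (subst (1 2) poly_mapping_eq_sum_basis)
    (simp add: linear_map_sum[OF assms(1)] linear_map_sum[OF assms(2)]
      linear_map_scale[OF assms(1)] linear_map_scale[OF assms(2)] assms(3))

text \<open>Cancellation can make the support of a sum smaller than the union of the supports.
  Additivity of \<open>lin_ext\<close> is therefore read off over one common finite index
  set.\<close>

lemma lin_ext_superset:
  assumes "finite A" "Poly_Mapping.keys x \<subseteq> A"
  shows "lin_ext f x = (\<Sum>b\<in>A. scale (Poly_Mapping.lookup x b) (f b))"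
  unfolding lin_ext_def using assms
  by (intro sum.mono_neutral_left) (auto simp: in_keys_iff scale_simps)

lemma linear_lin_ext:
  fixes f :: "'b \<Rightarrow> ('c \<Rightarrow>\<^sub>0 'k::field)"
  shows "linear_map (lin_ext f)"
proof (rule linear_mapI)
  fix x y :: "'b \<Rightarrow>\<^sub>0 'k"
  let ?A = "Poly_Mapping.keys x \<union> Poly_Mapping.keys y"
  have "lin_ext f (x + y) = (\<Sum>b\<in>?A. scale (Poly_Mapping.lookup (x + y) b) (f b))"
    by (intro lin_ext_superset) (simp_all add: Poly_Mapping.keys_add)
  moreover have "lin_ext f x = (\<Sum>b\<in>?A. scale (Poly_Mapping.lookup x b) (f b))"
    "lin_ext f y = (\<Sum>b\<in>?A. scale (Poly_Mapping.lookup y b) (f b))"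
    by (intro lin_ext_superset; auto)+
  ultimately show "lin_ext f (x + y) = lin_ext f x + lin_ext f y"
    by (simp add: lookup_add scale_simps sum.distrib)
next
  fix c x
  interpret V: vector_space "scale :: 'k \<Rightarrow> ('c \<Rightarrow>\<^sub>0 'k) \<Rightarrow> _" by (rule vector_space_scale)
  have "lin_ext f (scale c x) =
      (\<Sum>b\<in>Poly_Mapping.keys x. scale (Poly_Mapping.lookup (scale c x) b) (f b))"
    by (intro lin_ext_superset) (auto simp: in_keys_iff lookup_scale)
  then show "lin_ext f (scale c x) = scale c (lin_ext f x)"
    by (simp add: lin_ext_def V.scale_sum_right lookup_scale)
qed

lemma linear_map_lin_ext [intro!]: "linear_map h \<Longrightarrow> linear_map (\<lambda>x. lin_ext f (h x))"
  by (rule linear_mapI)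
    (simp_all add: linear_map_add[OF linear_lin_ext] linear_map_scale[OF linear_lin_ext]
      linear_map_add linear_map_scale)

lemma linear_map_compose: "linear_map f \<Longrightarrow> linear_map h \<Longrightarrow> linear_map (\<lambda>x. f (h x))"
  by (rule linear_mapI) (simp_all add: linear_map_add linear_map_scale)

lemma linear_map_ident [intro!]: "linear_map (\<lambda>x. x)" "linear_map id"
  by (auto intro: linear_mapI)

text \<open>In \<open>x \<otimes> y\<close> the second factor enters through the function that
  \<open>lin_ext\<close> extends, not through its argument; this lemma gives linearity in that
  place.\<close>

lemma linear_map_lin_ext_fun:
  fixes F :: "('a \<Rightarrow>\<^sub>0 'k::field) \<Rightarrow> 'b \<Rightarrow> ('c \<Rightarrow>\<^sub>0 'k)"
  assumes "\<And>b. linear_map (\<lambda>y. F y b)"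
  shows "linear_map (\<lambda>y. lin_ext (F y) x)"
proof (rule linear_mapI)
  fix y z
  show "lin_ext (F (y + z)) x = lin_ext (F y) x + lin_ext (F z) x"
    by (simp add: lin_ext_def linear_map_add[OF assms] scale_simps sum.distrib)
next
  fix c y
  interpret V: vector_space "scale :: 'k \<Rightarrow> ('c \<Rightarrow>\<^sub>0 'k) \<Rightarrow> _" by (rule vector_space_scale)
  show "lin_ext (F (scale c y)) x = scale c (lin_ext (F y) x)"
    by (simp add: lin_ext_def linear_map_scale[OF assms] V.scale_sum_right mult.commute)
qed

lemma linear_tensor_left: "linear_map (\<lambda>x. x \<otimes> y)"
  unfolding tensor_def by auto

lemma linear_tensor_right: "linear_map (\<lambda>y. x \<otimes> y)"
  unfolding tensor_def by (rule linear_map_lin_ext_fun) auto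

lemma linear_map_tensor [intro!]:
  "linear_map h \<Longrightarrow> linear_map (\<lambda>x. h x \<otimes> y)"
  "linear_map h \<Longrightarrow> linear_map (\<lambda>x. y \<otimes> h x)"
  using linear_map_compose[OF linear_tensor_left, of h y]
    linear_map_compose[OF linear_tensor_right, of h y] by auto

lemma tensor_sum_left: "sum f A \<otimes> y = (\<Sum>a\<in>A. f a \<otimes> y)"
  by (rule linear_map_sum[OF linear_tensor_left])

lemma tensor_sum_right: "x \<otimes> sum f A = (\<Sum>a\<in>A. x \<otimes> f a)"
  by (rule linear_map_sum[OF linear_tensor_right])

text \<open>The composed form lets introduction rules peel a nested expression from the outside. The
  inner map has its own name in every clause because its codomain differs from clause to
  clause.\<close>

lemma linear_map_structure_maps [intro!]:
  "linear_map h \<Longrightarrow> linear_map (\<lambda>x. tensor_map f g (h x))"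
  "linear_map h1 \<Longrightarrow> linear_map (\<lambda>x. tensor_assoc (h1 x))"
  "linear_map h2 \<Longrightarrow> linear_map (\<lambda>x. middle_swap (h2 x))"
  "linear_map h3 \<Longrightarrow> linear_map (\<lambda>x. counit_left \<epsilon> (h3 x))"
  "linear_map h4 \<Longrightarrow> linear_map (\<lambda>x. counit_right \<epsilon> (h4 x))"
  unfolding tensor_map_def tensor_assoc_def middle_swap_def counit_left_def counit_right_def by auto

text \<open>Multilinear identities are checked on basis vectors, one argument at a time.\<close>

lemma tensor_map_tensor:
  assumes "linear_map f" "linear_map g"
  shows "tensor_map f g (x \<otimes> y) = f x \<otimes> g y"
proof (rule linear_map_eqI[of _ _ x])
  fix b
  show "tensor_map f g (basis b \<otimes> y) = f (basis b) \<otimes> g y"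
    by (rule linear_map_eqI[of _ _ y])
      (auto simp: tensor_map_def tensor_basis lin_ext_basis intro: assms)
qed (auto intro: assms)

lemma tensor_assoc_tensor: "tensor_assoc ((x \<otimes> y) \<otimes> z) = x \<otimes> y \<otimes> z"
proof (rule linear_map_eqI[of _ _ x])
  fix b
  show "tensor_assoc ((basis b \<otimes> y) \<otimes> z) = basis b \<otimes> y \<otimes> z"
  proof (rule linear_map_eqI[of _ _ y])
    fix c
    show "tensor_assoc ((basis b \<otimes> basis c) \<otimes> z) = basis b \<otimes> basis c \<otimes> z"
      by (rule linear_map_eqI[of _ _ z]) (auto simp: tensor_assoc_def tensor_basis lin_ext_basis)
  qed auto
qed auto

lemma middle_swap_basis:
  "middle_swap ((basis a \<otimes> basis b) \<otimes> (basis c \<otimes> basis d)) =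
    (basis a \<otimes> basis c) \<otimes> (basis b \<otimes> basis d)"
  by (simp add: middle_swap_def tensor_basis lin_ext_basis)

text \<open>Pairs of basis elements are themselves the basis; they are presented as pure tensors so
  that \<open>tensor_map_tensor\<close> can rewrite them.\<close>

lemma tensor_eqI:
  assumes "linear_map f" "linear_map g" "\<And>b c. f (basis b \<otimes> basis c) = g (basis b \<otimes> basis c)"
  shows "f x = g x"
proof (rule linear_map_eqI[OF assms(1,2)])
  fix p show "f (basis p) = g (basis p)"
    using assms(3)[of "fst p" "snd p"] by (simp add: tensor_basis)
qed

lemma tensor3_eqI:
  assumes "linear_map f" "linear_map g"
    and "\<And>b c d. f ((basis b \<otimes> basis c) \<otimes> basis d) = g ((basis b \<otimes> basis c) \<otimes> basis d)"
  shows "f x = g x"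
proof (rule linear_map_eqI[OF assms(1,2)])
  fix p show "f (basis p) = g (basis p)"
    using assms(3)[of "fst (fst p)" "snd (fst p)" "snd p"] by (simp add: tensor_basis)
qed

text \<open>A linear form takes values in the field and so is no \<open>linear_map\<close>.
  Multiplying a fixed vector by it brings it within reach of comparison on basis vectors.\<close>

lemma linear_map_scale_form:
  "Vector_Spaces.linear scale (*) e \<Longrightarrow> linear_map (\<lambda>x. scale (e x) u)"
  by (rule linear_mapI)
    (simp_all add: linear_iff_module_hom module_hom.add module_hom.scale scale_simps)


section \<open>Convolution in a bialgebra\<close>

context bialgebra
begin

definition conv :: "(('b \<Rightarrow>\<^sub>0 'k) \<Rightarrow> ('b \<Rightarrow>\<^sub>0 'k)) \<Rightarrow> (('b \<Rightarrow>\<^sub>0 'k) \<Rightarrow> ('b \<Rightarrow>\<^sub>0 'k)) \<Rightarrow>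
    ('b \<Rightarrow>\<^sub>0 'k) \<Rightarrow> ('b \<Rightarrow>\<^sub>0 'k)" where
  "conv f g x = m (tensor_map f g (\<Delta> x))"

lemma linear_conv: "linear_map (conv f g)"
  unfolding conv_def
  by (intro linear_map_compose[OF linear_m] linear_map_structure_maps linear_\<Delta>)

lemma linear_counit_unit: "linear_map (\<lambda>x. scale (\<epsilon> x) u)"
  by (rule linear_map_scale_form[OF linear_\<epsilon>])

text \<open>Both sides are an iterated product after \<open>f\<close>, \<open>g\<close>,
  \<open>h\<close> on three tensor factors after an iterated coproduct, differing only in the
  bracketing. Associativity of \<open>m\<close> and coassociativity of \<open>\<Delta>\<close> match
  the outer and inner stages.\<close>

lemma conv_assoc:
  assumes "linear_map f" "linear_map g" "linear_map h"
  shows "conv (conv f g) h = conv f (conv g h)"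
proof
  fix x
  have *: "linear_map (\<lambda>z. m z)" "linear_map (\<lambda>z. \<Delta> z)" by (rule linear_m, rule linear_\<Delta>)
  note lin = linear_map_structure_maps linear_map_ident * assms linear_conv
    linear_map_compose[OF linear_m] linear_map_compose[OF linear_\<Delta>]
  have 1: "tensor_map (conv f g) h z =
      tensor_map m id (tensor_map (tensor_map f g) h (tensor_map \<Delta> id z))" for z
    by (rule tensor_eqI[of _ _ z]) (simp_all add: lin tensor_map_tensor conv_def)
  have 2: "tensor_map f (conv g h) z =
      tensor_map id m (tensor_map f (tensor_map g h) (tensor_map id \<Delta> z))" for z
    by (rule tensor_eqI[of _ _ z]) (simp_all add: lin tensor_map_tensor conv_def)
  \<comment> \<open>Naturality of the associator, needed to carry it from the side of
    \<open>m\<close> past \<open>f\<close>, \<open>g\<close>, \<open>h\<close> to the side of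
    \<open>\<Delta>\<close>.\<close>
  have 3: "tensor_assoc (tensor_map (tensor_map f g) h z) =
      tensor_map f (tensor_map g h) (tensor_assoc z)" for z
    by (rule tensor3_eqI[of _ _ z]) (simp_all add: lin tensor_map_tensor tensor_assoc_tensor)
  show "conv (conv f g) h x = conv f (conv g h) x"
    unfolding conv_def[of _ _ x] 1 2 m_assoc 3 coassoc ..
qed

text \<open>The unit law alone gives the identity on every tensor \<open>z\<close>, with
  \<open>counit_left\<close> on the right; the counit law enters only at
  \<open>z = \<Delta> x\<close>.\<close>

lemma conv_counit_left:
  assumes "linear_map f"
  shows "conv (\<lambda>x. scale (\<epsilon> x) u) f = f"
proof
  fix x
  have "m (tensor_map (\<lambda>x. scale (\<epsilon> x) u) f z) = f (counit_left \<epsilon> z)" for z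
  proof (rule tensor_eqI[of _ _ z])
    fix b c
    show "m (tensor_map (\<lambda>x. scale (\<epsilon> x) u) f (basis b \<otimes> basis c)) =
        f (counit_left \<epsilon> (basis b \<otimes> basis c))"
      by (simp only: tensor_map_tensor linear_counit_unit assms linear_map_scale[OF linear_tensor_left]
          linear_map_scale[OF linear_m] m_unit_left)
        (simp add: counit_left_def tensor_basis lin_ext_basis linear_map_scale[OF assms])
  qed (intro linear_map_compose[OF linear_m] linear_map_compose[OF assms]
      linear_map_structure_maps linear_map_ident)+
  then show "conv (\<lambda>x. scale (\<epsilon> x) u) f x = f x"
    by (simp add: conv_def counit_law_left)
qed

lemma conv_counit_right:
  assumes "linear_map f"
  shows "conv f (\<lambda>x. scale (\<epsilon> x) u) = f"
proof
  fix x
  have "m (tensor_map f (\<lambda>x. scale (\<epsilon> x) u) z) = f (counit_right \<epsilon> z)" for z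
  proof (rule tensor_eqI[of _ _ z])
    fix b c
    show "m (tensor_map f (\<lambda>x. scale (\<epsilon> x) u) (basis b \<otimes> basis c)) =
        f (counit_right \<epsilon> (basis b \<otimes> basis c))"
      by (subst tensor_map_tensor; simp add: linear_counit_unit assms linear_map_scale[OF linear_tensor_right]
          linear_map_scale[OF linear_m] m_unit_right)
        (simp add: counit_right_def tensor_basis lin_ext_basis linear_map_scale[OF assms])
  qed (intro linear_map_compose[OF linear_m] linear_map_compose[OF assms]
      linear_map_structure_maps linear_map_ident)+
  then show "conv f (\<lambda>x. scale (\<epsilon> x) u) x = f x"
    by (simp add: conv_def counit_law_right)
qed

lemma antipode_from_inverses:
  assumes "linear_map L" "linear_map R"
    and "conv L id = (\<lambda>x. scale (\<epsilon> x) u)" "conv id R = (\<lambda>x. scale (\<epsilon> x) u)"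
  shows "is_antipode m u \<Delta> \<epsilon> L"
proof -
  have "L = conv L (conv id R)" by (simp only: assms(4) conv_counit_right[OF assms(1)])
  also have "\<dots> = conv (conv L id) R"
    by (rule conv_assoc[symmetric]) (simp_all only: assms(1,2) linear_map_ident)
  also have "\<dots> = R" by (simp only: assms(3) conv_counit_left[OF assms(2)])
  finally have "conv id L = (\<lambda>x. scale (\<epsilon> x) u)" using assms(4) by simp
  then show ?thesis using assms(1,3) by (simp add: is_antipode_def conv_def fun_eq_iff)
qed

end

section \<open>Shrinkings and ordinal sums\<close>

lemma tag_of_eq_of_iso:
  "is_tag G \<Longrightarrow> is_tag H \<Longrightarrow> graph_iso G H f g \<Longrightarrow> tag_of G = tag_of H"
  by (rule tag_of_eqI) (auto simp: tag_iso_def)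

lemma edges_subgraph [simp]: "edges (subgraph G A) = A"
  by (simp add: subgraph_def)

lemma edges_shrink [simp]: "edges (shrink G \<gamma>) = edges G - edges \<gamma>"
  by (simp add: shrink_def)

lemma graph_sel:
  "verts (subgraph G A) = incident G A" "ends (subgraph G A) = ends G"
  "eord (subgraph G A) = Restr (eord G) A"
  "verts (shrink G \<gamma>) = component \<gamma> ` incident G (edges G - edges \<gamma>)"
  "ends (shrink G \<gamma>) = map_uprod (component \<gamma>) \<circ> ends G"
  "eord (shrink G \<gamma>) = Restr (eord G) (edges G - edges \<gamma>)"
  by (simp_all add: subgraph_def shrink_def)

lemma card_edges_rep_tag:
  assumes "is_tag G"
  shows "card (edges (rep_tag (tag_of G))) = card (edges G)"
  using tag_iso_rep_tag[OF assms] unfolding tag_iso_def graph_iso_def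
  by (metis bij_betw_same_card)

text \<open>Having no edges determines the class because \<open>is_tag\<close> makes every vertex
  incident to an edge.\<close>

lemma tag_of_eq_empty_iff:
  assumes "is_tag G"
  shows "tag_of G = tag_of (empty_graph :: ('w, 'f) graph) \<longleftrightarrow> edges G = {}"
proof
  assume "tag_of G = tag_of (empty_graph :: ('w, 'f) graph)"
  then obtain f g where "graph_iso G (empty_graph :: ('w, 'f) graph) f g"
    unfolding tag_of_eq_iff[OF assms is_tag_empty_graph] tag_iso_def by blast
  then show "edges G = {}" by (simp add: graph_iso_def empty_graph_def bij_betw_def)
next
  assume "edges G = {}"
  \<comment> \<open>There are neither vertices nor edges to map, so any functions serve.\<close>
  then have "graph_iso G (empty_graph :: ('w, 'f) graph) undefined undefined"
    using assms by (simp add: graph_iso_def empty_graph_def is_tag_def bij_betw_def)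
  then show "tag_of G = tag_of (empty_graph :: ('w, 'f) graph)"
    by (rule tag_of_eq_of_iso[OF assms is_tag_empty_graph])
qed

section \<open>Connected components and iterated contraction\<close>

lemma adj_sym: "sym (adj \<gamma>)"
  by (auto simp: sym_def adj_def) (metis Upair_inject)

lemma component_eqI: "(v, w) \<in> (adj \<gamma>)\<^sup>* \<Longrightarrow> component \<gamma> v = component \<gamma> w"
  using sym_rtrancl[OF adj_sym, of \<gamma>] unfolding component_def
  by (auto dest: symD intro: rtrancl_trans)

lemma subgraph_subgraph: "B \<subseteq> A \<Longrightarrow> subgraph (subgraph G A) B = subgraph G B"
  by (auto simp: subgraph_def)

text \<open>An equality of records, not merely an isomorphism: \<open>is_tag\<close> leaves no
  vertex outside the incident ones and no pair of the order outside the edges.\<close>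

lemma subgraph_edges: "is_tag G \<Longrightarrow> subgraph G (edges G) = G"
  by (cases G) (auto simp: subgraph_def is_tag_def order_on_defs)

text \<open>Both sides have components of \<open>B\<close> as vertices and \<open>A - B\<close> as
  edges, so they coincide literally; only the nested restrictions of the order have to be
  reconciled.\<close>

lemma shrink_subgraph:
  assumes "B \<subseteq> A" "A \<subseteq> edges G"
  shows "shrink (subgraph G A) (subgraph G B) = subgraph (shrink G (subgraph G B)) (A - B)"
proof -
  have "Restr (Restr r A) (A - B) = Restr (Restr r (edges G - B)) (A - B)" for r
    using assms by auto
  then show ?thesis
    by (auto simp: shrink_def subgraph_def uprod.set_map)
qed

text \<open>The component of \<open>v\<close> in \<open>A\<close> is the union of the components in \<open>B\<close> that form its component
  in \<open>G/B\<close>, so taking unions inverts the vertex map of the isomorphism below.\<close>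

lemma component_shrink:
  assumes "B \<subseteq> A" "A \<subseteq> edges G"
  shows "component (subgraph (shrink G (subgraph G B)) (A - B)) (component (subgraph G B) v) =
    component (subgraph G B) ` component (subgraph G A) v"
proof -
  let ?b = "component (subgraph G B)"
  let ?r = "adj (subgraph G A)" and ?s = "adj (subgraph (shrink G (subgraph G B)) (A - B))"
  have sub: "(adj (subgraph G B))\<^sup>* \<subseteq> ?r\<^sup>*"
    using assms(1) by (intro rtrancl_mono) (auto simp: adj_def subgraph_def)
  \<comment> \<open>Along a path in \<open>A\<close>, an edge of \<open>B\<close> stays inside one
    component of \<open>B\<close>, and any other edge survives in the quotient.\<close>
  have 1: "(?b v, ?b w) \<in> ?s\<^sup>*" if "(v, w) \<in> ?r\<^sup>*" for w
    using that
  proof induction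
    case (step w x)
    obtain e where e: "e \<in> A" "ends G e = Upair w x"
      using step(2) by (auto simp: adj_def subgraph_def)
    show ?case
    proof (cases "e \<in> B")
      case True
      then have "(w, x) \<in> adj (subgraph G B)" using e by (auto simp: adj_def subgraph_def)
      then have "?b w = ?b x" by (intro component_eqI) auto
      then show ?thesis using step(3) by simp
    next
      case False
      then have "(?b w, ?b x) \<in> ?s"
        using e by (auto simp: adj_def subgraph_def shrink_def intro!: bexI[of _ e])
      then show ?thesis using step(3) by (rule rtrancl_into_rtrancl[rotated])
    qed
  qed simp
  have 2: "\<exists>w. X = ?b w \<and> (v, w) \<in> ?r\<^sup>*" if "(?b v, X) \<in> ?s\<^sup>*" for X
    using that
  proof induction
    case (step X Y)
    obtain w where w: "X = ?b w" "(v, w) \<in> ?r\<^sup>*" using step(3) by blast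
    obtain e where e: "e \<in> A - B" "map_uprod ?b (ends G e) = Upair X Y"
      using step(2) by (auto simp: adj_def subgraph_def shrink_def)
    obtain p q where pq: "ends G e = Upair p q" "?b p = X" "?b q = Y"
      using e(2) by (cases "ends G e") auto
    \<comment> \<open>The lifted edge starts at \<open>p\<close>, not at the vertex \<open>w\<close>
      reached so far. Both lie in the same component of \<open>B\<close>, and a path in
      \<open>B\<close>, which is also a path in \<open>A\<close>, joins them.\<close>
    have "p \<in> ?b w" using pq(2) w(1) by (auto simp: component_def)
    then have "(w, p) \<in> ?r\<^sup>*" using sub by (auto simp: component_def)
    moreover have "(p, q) \<in> ?r" using e(1) pq(1) by (auto simp: adj_def subgraph_def)
    ultimately have "(v, q) \<in> ?r\<^sup>*" using w(2) by (meson rtrancl_trans rtrancl_into_rtrancl)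
    then show ?case using pq(3) by blast
  qed blast
  have "?s\<^sup>* `` {?b v} = ?b ` (?r\<^sup>* `` {v})" using 1 2 by blast
  then show ?thesis unfolding component_def .
qed

text \<open>The edges agree; only the vertex types differ. The isomorphism sends a component of
  \<open>A\<close> to the set of components of \<open>B\<close> that make it up.\<close>

lemma tag_of_shrink_shrink:
  assumes "is_tag G" "B \<subseteq> A" "A \<subseteq> edges G"
  shows "tag_of (shrink G (subgraph G A)) =
    tag_of (shrink (shrink G (subgraph G B)) (subgraph (shrink G (subgraph G B)) (A - B)))"
proof -
  let ?a = "component (subgraph G A)" and ?b = "component (subgraph G B)"
  let ?c = "component (subgraph (shrink G (subgraph G B)) (A - B))"
  have c: "?c (?b v) = ?b ` ?a v" for v by (rule component_shrink[OF assms(2,3)])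
  have ab: "\<Union> (?b ` ?a v) = ?a v" for v
  proof -
    have "(adj (subgraph G B))\<^sup>* \<subseteq> (adj (subgraph G A))\<^sup>*"
      using assms(2) by (intro rtrancl_mono) (auto simp: adj_def subgraph_def)
    then have "?b w \<subseteq> ?a v" "w \<in> ?b w" if "w \<in> ?a v" for w
      using that unfolding component_def by (auto intro: rtrancl_trans)
    then show ?thesis by blast
  qed
  have D: "edges G - B - (A - B) = edges G - A" using assms(2,3) by blast
  have "inj_on (image ?b) (?a ` X)" for X
    by (rule inj_on_inverseI[where g = Union]) (metis ab imageE)
  moreover have "?c ` incident (shrink G (subgraph G B)) (edges G - B - (A - B)) =
      image ?b ` ?a ` incident G (edges G - A)"
    unfolding D graph_sel edges_subgraph comp_def uprod.set_map image_UN[symmetric] image_image c ..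
  ultimately have "graph_iso (shrink G (subgraph G A))
      (shrink (shrink G (subgraph G B)) (subgraph (shrink G (subgraph G B)) (A - B))) (image ?b) id"
    unfolding graph_iso_def bij_betw_def edges_shrink edges_subgraph D graph_sel
    using assms(2) by (auto simp: uprod.map_comp comp_def c)
  then show ?thesis
    by (rule tag_of_eq_of_iso[OF is_tag_shrink[OF assms(1)] is_tag_shrink[OF is_tag_shrink[OF assms(1)]]])
qed

text \<open>Contracting nothing still replaces every vertex by its singleton, so the result agrees
  with \<open>G\<close> only up to isomorphism.\<close>

lemma tag_of_shrink_empty:
  assumes "is_tag G"
  shows "tag_of (shrink G (subgraph G {})) = tag_of G"
proof -
  have "component (subgraph G {}) = (\<lambda>v. {v})"
    by (auto simp: component_def adj_def subgraph_def)
  then have "graph_iso G (shrink G (subgraph G {})) (\<lambda>v. {v}) id"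
    using assms by (auto simp: graph_iso_def bij_betw_def shrink_def is_tag_def subgraph_def)
  then show ?thesis using tag_of_eq_of_iso[OF assms is_tag_shrink[OF assms]] by metis
qed

section \<open>Ordinal sums: unit, associativity, subgraphs and shrinkings\<close>

lemma tag_of_ordinal_sum_empty:
  assumes "is_tag G"
  shows "tag_of (ordinal_sum (empty_graph :: ('w, 'f) graph) G) = tag_of G"
    and "tag_of (ordinal_sum G (empty_graph :: ('w, 'f) graph)) = tag_of G"
proof -
  have "graph_iso G (ordinal_sum (empty_graph :: ('w, 'f) graph) G) Inr Inr"
    "graph_iso G (ordinal_sum G (empty_graph :: ('w, 'f) graph)) Inl Inl"
    by (auto simp: graph_iso_def bij_betw_def empty_graph_def)
  then show "tag_of (ordinal_sum (empty_graph :: ('w, 'f) graph) G) = tag_of G"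
    "tag_of (ordinal_sum G (empty_graph :: ('w, 'f) graph)) = tag_of G"
    using tag_of_eq_of_iso[OF assms] is_tag_ordinal_sum assms is_tag_empty_graph by metis+
qed

lemma tag_of_ordinal_sum_assoc:
  assumes "is_tag G" "is_tag H" "is_tag K"
  shows "tag_of (ordinal_sum (ordinal_sum G H) K) = tag_of (ordinal_sum G (ordinal_sum H K))"
proof -
  \<comment> \<open>The element types are generic because the same rebracketing serves for vertices
    and for edges.\<close>
  have bij: "bij_betw (case_sum (map_sum id Inl) (\<lambda>x. Inr (Inr x)))
      ((A <+> B) <+> C) (A <+> B <+> C)" for A :: "'x set" and B :: "'y set" and C :: "'z set"
    by (auto simp: bij_betw_def inj_on_def Plus_def image_Un image_image)
  have "graph_iso (ordinal_sum (ordinal_sum G H) K) (ordinal_sum G (ordinal_sum H K))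
      (case_sum (map_sum id Inl) (\<lambda>x. Inr (Inr x))) (case_sum (map_sum id Inl) (\<lambda>x. Inr (Inr x)))"
    unfolding graph_iso_def
    by (auto simp: bij uprod.map_comp comp_def)
  then show ?thesis by (intro tag_of_eq_of_iso is_tag_ordinal_sum assms)
qed

text \<open>The hypothesis says that \<open>f\<close> maps steps to steps and also that no step from
  the range of \<open>f\<close> leaves that range. Paths starting at \<open>f x\<close> therefore
  lift one step at a time.\<close>

lemma rtrancl_Image_semiconj:
  assumes "\<And>x. r `` {f x} = f ` (s `` {x})"
  shows "r\<^sup>* `` {f x} = f ` (s\<^sup>* `` {x})"
proof -
  have "\<exists>z. y = f z \<and> (x, z) \<in> s\<^sup>*" if "(f x, y) \<in> r\<^sup>*" for y
    using that
  proof induction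
    case (step y z)
    then show ?case using assms
      by (auto simp: set_eq_iff) (metis Image_singleton_iff assms imageE rtrancl.rtrancl_into_rtrancl)
  qed blast
  moreover have "(f x, f z) \<in> r\<^sup>*" if "(x, z) \<in> s\<^sup>*" for z
    using that
  proof induction
    case (step y z)
    then have "f z \<in> r `` {f y}" using assms by auto
    then show ?case using step(3) by auto
  qed blast
  ultimately show ?thesis by auto
qed

lemma image_Plus: "h ` (A <+> B) = (\<lambda>a. h (Inl a)) ` A \<union> (\<lambda>b. h (Inr b)) ` B"
  by (simp add: Plus_def image_Un image_image)

lemma Inl_image_eq_Inr_image_iff:
  "Inl ` A = Inr ` B \<longleftrightarrow> A = {} \<and> B = {}" "Inr ` B = Inl ` A \<longleftrightarrow> A = {} \<and> B = {}"
  by blast+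

text \<open>No edge joins the two summands, so the neighbours of a tagged vertex are the tagged
  neighbours of the vertex; \<open>rtrancl_Image_semiconj\<close> passes from neighbours to
  components.\<close>

lemma component_ordinal_sum:
  "component (subgraph (ordinal_sum G H) (A <+> B)) (Inl v) = Inl ` component (subgraph G A) v"
  "component (subgraph (ordinal_sum G H) (A <+> B)) (Inr w) = Inr ` component (subgraph H B) w"
proof -
  let ?r = "adj (subgraph (ordinal_sum G H) (A <+> B))"
  have l: "map_uprod Inl p = Upair (Inl x) y \<longleftrightarrow> (\<exists>z. y = Inl z \<and> p = Upair x z)"
    for p x and y :: "_ + _"
    by (cases p) auto
  have r: "map_uprod Inr p = Upair (Inr x) y \<longleftrightarrow> (\<exists>z. y = Inr z \<and> p = Upair x z)"
    for p x and y :: "_ + _"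
    by (cases p) auto
  have n: "map_uprod Inl p \<noteq> Upair (Inr x) y" "map_uprod Inr q \<noteq> Upair (Inl z) y'"
    for p q x z and y y' :: "_ + _"
    by (cases p; auto) (cases q; auto)
  have "?r `` {Inl x} = Inl ` (adj (subgraph G A) `` {x})" for x
    by (auto simp: adj_def subgraph_def l n Plus_def bex_Un)
  then show "component (subgraph (ordinal_sum G H) (A <+> B)) (Inl v) = Inl ` component (subgraph G A) v"
    unfolding component_def by (rule rtrancl_Image_semiconj)
  have "?r `` {Inr x} = Inr ` (adj (subgraph H B) `` {x})" for x
    by (auto simp: adj_def subgraph_def r n Plus_def bex_Un)
  then show "component (subgraph (ordinal_sum G H) (A <+> B)) (Inr w) = Inr ` component (subgraph H B) w"
    unfolding component_def by (rule rtrancl_Image_semiconj)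
qed

lemma incident_ordinal_sum:
  "incident (ordinal_sum G H) (A <+> B) = incident G A <+> incident H B"
  by (auto simp: Plus_def uprod.set_map)

lemma tag_of_subgraph_ordinal_sum:
  assumes "is_tag G" "is_tag H" "A \<subseteq> edges G" "B \<subseteq> edges H"
  shows "tag_of (subgraph (ordinal_sum G H) (A <+> B)) =
    tag_of (ordinal_sum (subgraph G A) (subgraph H B))"
proof -
  have "(x, y) \<in> eord (ordinal_sum G H) \<longleftrightarrow> (x, y) \<in> eord (ordinal_sum (subgraph G A) (subgraph H B))"
    if "x \<in> A <+> B" "y \<in> A <+> B" for x y
    using that assms(3,4) by (cases x; cases y) (auto simp: subgraph_def)
  moreover have "ends (ordinal_sum (subgraph G A) (subgraph H B)) x = ends (ordinal_sum G H) x" for x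
    by (cases x) (auto simp: subgraph_def)
  ultimately have "graph_iso (subgraph (ordinal_sum G H) (A <+> B))
      (ordinal_sum (subgraph G A) (subgraph H B)) id id"
    using incident_ordinal_sum[of G H A B]
    by (simp add: graph_iso_def uprod.map_id) (simp add: subgraph_def)
  then show ?thesis
    using assms by (intro tag_of_eq_of_iso is_tag_subgraph is_tag_ordinal_sum) auto
qed

text \<open>On the left a vertex is a set of tagged points, on the right a tagged set. The vertex
  map \<open>?f\<close> moves the tag inside, so the isomorphism is built from the right-hand graph
  to the left-hand one.\<close>

lemma tag_of_shrink_ordinal_sum:
  assumes "is_tag G" "is_tag H" "A \<subseteq> edges G" "B \<subseteq> edges H"
  shows "tag_of (shrink (ordinal_sum G H) (subgraph (ordinal_sum G H) (A <+> B))) =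
    tag_of (ordinal_sum (shrink G (subgraph G A)) (shrink H (subgraph H B)))"
proof -
  let ?f = "case_sum (image Inl) (image Inr)"
  let ?G = "shrink G (subgraph G A)" and ?H = "shrink H (subgraph H B)"
  let ?S = "shrink (ordinal_sum G H) (subgraph (ordinal_sum G H) (A <+> B))"
  have E: "edges G <+> edges H - (A <+> B) = (edges G - A) <+> (edges H - B)" by auto
  have V: "verts ?S = ?f ` verts (ordinal_sum ?G ?H)"
  proof -
    let ?c = "component (subgraph (ordinal_sum G H) (A <+> B))"
    have "verts ?S = ?c ` incident (ordinal_sum G H) ((edges G - A) <+> (edges H - B))"
      by (simp only: shrink_def graph.simps edges_subgraph ordinal_sum_simps(2) E)
    also have "\<dots> = ?c ` (incident G (edges G - A) <+> incident H (edges H - B))"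
      by (simp only: incident_ordinal_sum)
    also have "\<dots> = ?f ` verts (ordinal_sum ?G ?H)"
      by (simp only: shrink_def graph.simps edges_subgraph ordinal_sum_simps(1)
          image_Plus image_image component_ordinal_sum sum.case)
    finally show ?thesis .
  qed
  \<comment> \<open>\<open>image Inl\<close> and \<open>image Inr\<close> can agree only on empty
    sets, so injectivity of \<open>?f\<close> rests on components being nonempty.\<close>
  have "{} \<notin> verts ?G" "{} \<notin> verts ?H"
    by (auto simp: shrink_def component_def)
  then have "inj_on ?f (verts (ordinal_sum ?G ?H))"
    unfolding ordinal_sum_simps(1)
    by (intro inj_onI) (elim PlusE; auto simp: inj_image_eq_iff Inl_image_eq_Inr_image_iff)
  moreover have "ends ?S e = map_uprod ?f (ends (ordinal_sum ?G ?H) e)" for e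
    by (cases e) (simp_all add: shrink_def uprod.map_comp comp_def component_ordinal_sum)
  moreover have "(x, y) \<in> eord (ordinal_sum ?G ?H) \<longleftrightarrow> (x, y) \<in> eord ?S"
    if "x \<in> edges (ordinal_sum ?G ?H)" "y \<in> edges (ordinal_sum ?G ?H)" for x y
    using that by (cases x; cases y) (auto simp: shrink_def)
  ultimately have "graph_iso (ordinal_sum ?G ?H) ?S ?f id"
    using V E by (auto simp: graph_iso_def bij_betw_def)
  then show ?thesis
    using assms by (intro tag_of_eq_of_iso[symmetric] is_tag_shrink is_tag_ordinal_sum) auto
qed

section \<open>The bialgebra of totally assigned graphs\<close>

lemma linear_tag_mult: "linear_map tag_mult"
  unfolding tag_mult_def by (rule linear_lin_ext)

lemma linear_tag_comult: "linear_map tag_comult"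
  unfolding tag_comult_def by (rule linear_lin_ext)

lemma linear_tag_counit:
  "Vector_Spaces.linear scale (*) (tag_counit :: 'k::field tag_space \<Rightarrow> 'k)"
proof -
  interpret V: vector_space "scale :: 'k \<Rightarrow> 'k tag_space \<Rightarrow> _" by (rule vector_space_scale)
  show ?thesis
    by unfold_locales (auto simp: tag_counit_def lookup_add lookup_scale algebra_simps)
qed

lemmas linear_tag_maps =
  linear_map_ident linear_map_structure_maps linear_map_tensor linear_tag_mult linear_tag_comult
  linear_map_compose[OF linear_tag_mult] linear_map_compose[OF linear_tag_comult]

lemma tag_cases:
  obtains G :: "(nat, nat) graph" where "is_tag G" "t = tag_of G"
  using is_tag_rep_tag tag_of_rep_tag by metis

lemma tag_space_eqI:
  assumes "linear_map f" "linear_map g"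
    and "\<And>G :: (nat, nat) graph. is_tag G \<Longrightarrow> f (tag_vec G) = g (tag_vec G)"
  shows "f x = g x"
  by (rule linear_map_eqI[OF assms(1,2)]) (metis assms(3) tag_cases)

lemma sum_subgraphs: "sum f (subgraphs G) = (\<Sum>A\<in>Pow (edges G). f (subgraph G A))"
  unfolding subgraphs_def by (simp add: sum.reindex[OF inj_on_subgraph])

lemma tag_comult_tag_vec_Pow:
  "is_tag G \<Longrightarrow> tag_comult (tag_vec G) =
    (\<Sum>A\<in>Pow (edges G). tag_vec (subgraph G A) \<otimes> tag_vec (shrink G (subgraph G A)))"
  by (simp only: tag_comult_tag_vec sum_subgraphs)

lemma tag_counit_tag_vec: "is_tag G \<Longrightarrow> tag_counit (tag_vec G) = (if edges G = {} then 1 else 0)"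
  by (simp add: tag_counit_def lookup_single when_def tag_of_eq_empty_iff)

lemma tag_vec_empty: "is_tag G \<Longrightarrow> edges G = {} \<Longrightarrow> tag_vec G = tag_unit"
  unfolding tag_unit_def by (metis tag_of_eq_empty_iff)

section \<open>Algebra axioms\<close>

lemma tag_mult_assoc:
  "tag_mult (tensor_map tag_mult id x) = tag_mult (tensor_map id tag_mult (tensor_assoc x))"
proof (rule tensor3_eqI[of _ _ x])
  fix a b c
  obtain G H K :: "(nat, nat) graph" where
    "is_tag G" "a = tag_of G" "is_tag H" "b = tag_of H" "is_tag K" "c = tag_of K"
    by (metis tag_cases)
  then show "tag_mult (tensor_map tag_mult id ((basis a \<otimes> basis b) \<otimes> basis c)) =
      tag_mult (tensor_map id tag_mult (tensor_assoc ((basis a \<otimes> basis b) \<otimes> basis c)))"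
    by (simp only: tensor_assoc_tensor tensor_map_tensor linear_tag_maps id_apply tag_mult_tag_vec
        is_tag_ordinal_sum tag_of_ordinal_sum_assoc)
qed (intro linear_tag_maps)+

lemma tag_mult_unit:
  "tag_unit \<cdot> x = x" "x \<cdot> tag_unit = x"
proof -
  show "tag_unit \<cdot> x = x"
    by (rule tag_space_eqI[of _ _ x])
      (auto simp only: tag_unit_def tag_mult_tag_vec is_tag_empty_graph tag_of_ordinal_sum_empty
        intro: linear_tag_maps)
  show "x \<cdot> tag_unit = x"
    by (rule tag_space_eqI[of _ _ x])
      (auto simp only: tag_unit_def tag_mult_tag_vec is_tag_empty_graph tag_of_ordinal_sum_empty
        intro: linear_tag_maps)
qed

section \<open>Coalgebra axioms\<close>

lemma tag_comult_coassoc: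
  "tensor_assoc (tensor_map tag_comult id (tag_comult x)) = tensor_map id tag_comult (tag_comult x)"
proof (rule tag_space_eqI[of _ _ x])
  fix G :: "(nat, nat) graph"
  assume G: "is_tag G"
  let ?s = "subgraph G" and ?q = "\<lambda>A. shrink G (subgraph G A)"
  let ?E = "edges G"
  have fin: "finite ?E" using G by (simp add: is_tag_def)
  have "tensor_assoc (tensor_map tag_comult id (tag_comult (tag_vec G))) =
      (\<Sum>A\<in>Pow ?E. \<Sum>B\<in>Pow A. tag_vec (?s B) \<otimes> tag_vec (shrink (?s A) (?s B)) \<otimes> tag_vec (?q A))"
    unfolding tag_comult_tag_vec_Pow[OF G]
    by (simp only: linear_map_sum[OF linear_map_structure_maps(1)[OF linear_map_ident(1)]]
        linear_map_sum[OF linear_map_structure_maps(2)[OF linear_map_ident(1)]]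
        tensor_map_tensor linear_tag_maps)
      (auto simp only: linear_map_sum[OF linear_map_structure_maps(2)[OF linear_map_ident(1)]]
        tag_comult_tag_vec_Pow is_tag_subgraph[OF G] edges_subgraph tensor_sum_left id_apply
        tensor_assoc_tensor subgraph_subgraph intro!: sum.cong)
  also have "\<dots> = (\<Sum>(A, B)\<in>(SIGMA A:Pow ?E. Pow A).
      tag_vec (?s B) \<otimes> tag_vec (shrink (?s A) (?s B)) \<otimes> tag_vec (?q A))"
    using fin by (intro sum.Sigma) (auto intro: finite_subset)
  also have "\<dots> = (\<Sum>(B, C)\<in>(SIGMA B:Pow ?E. Pow (?E - B)).
      tag_vec (?s B) \<otimes> tag_vec (subgraph (?q B) C) \<otimes> tag_vec (shrink (?q B) (subgraph (?q B) C)))"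
    \<comment> \<open>The middle tensor factors agree already as graphs, the last ones only as
      classes.\<close>
    by (rule sum.reindex_bij_witness[where i = "\<lambda>(B, C). (B \<union> C, B)" and j = "\<lambda>(A, B). (B, A - B)"])
      (auto simp: shrink_subgraph tag_of_shrink_shrink[OF G])
  also have "\<dots> = (\<Sum>B\<in>Pow ?E. \<Sum>C\<in>Pow (?E - B).
      tag_vec (?s B) \<otimes> tag_vec (subgraph (?q B) C) \<otimes> tag_vec (shrink (?q B) (subgraph (?q B) C)))"
    using fin by (intro sum.Sigma[symmetric]) auto
  also have "\<dots> = tensor_map id tag_comult (tag_comult (tag_vec G))"
    unfolding tag_comult_tag_vec_Pow[OF G]
    by (simp only: linear_map_sum[OF linear_map_structure_maps(1)[OF linear_map_ident(1)]]
        tensor_map_tensor linear_tag_maps tag_comult_tag_vec_Pow is_tag_shrink[OF G]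
        edges_shrink edges_subgraph tensor_sum_right id_apply)
  finally show "tensor_assoc (tensor_map tag_comult id (tag_comult (tag_vec G))) =
      tensor_map id tag_comult (tag_comult (tag_vec G))" .
qed (intro linear_tag_maps)+

lemma counit_left_tensor: "counit_left \<epsilon> (basis b \<otimes> basis c) = scale (\<epsilon> (basis b)) (basis c)"
  by (simp add: counit_left_def tensor_basis lin_ext_basis)

lemma counit_right_tensor: "counit_right \<epsilon> (basis b \<otimes> basis c) = scale (\<epsilon> (basis c)) (basis b)"
  by (simp add: counit_right_def tensor_basis lin_ext_basis)

text \<open>The counit keeps one summand: on the left the empty subgraph, whose quotient is
  \<open>G\<close> up to isomorphism, and on the right \<open>G\<close> itself, the only subgraph
  whose quotient has no edges.\<close>

lemma tag_counit_laws:
  "counit_left tag_counit (tag_comult x) = x" "counit_right tag_counit (tag_comult x) = x"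
proof -
  show "counit_left tag_counit (tag_comult x) = x"
  proof (rule tag_space_eqI[of _ _ x])
    fix G :: "(nat, nat) graph"
    assume G: "is_tag G"
    have "counit_left tag_counit (tag_comult (tag_vec G)) = (\<Sum>A\<in>Pow (edges G).
        scale (tag_counit (tag_vec (subgraph G A))) (tag_vec (shrink G (subgraph G A))))"
      unfolding tag_comult_tag_vec_Pow[OF G]
      by (simp only: linear_map_sum[OF linear_map_structure_maps(4)[OF linear_map_ident(1)]]
          counit_left_tensor)
    also have "\<dots> = (\<Sum>A\<in>Pow (edges G). if A = {} then tag_vec G else 0)"
      by (intro sum.cong refl)
        (auto simp: tag_counit_tag_vec is_tag_subgraph[OF G] scale_simps tag_of_shrink_empty[OF G])
    finally show "counit_left tag_counit (tag_comult (tag_vec G)) = tag_vec G"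
      using G by (simp add: sum.delta is_tag_def)
  qed (intro linear_tag_maps)+
  show "counit_right tag_counit (tag_comult x) = x"
  proof (rule tag_space_eqI[of _ _ x])
    fix G :: "(nat, nat) graph"
    assume G: "is_tag G"
    have "counit_right tag_counit (tag_comult (tag_vec G)) = (\<Sum>A\<in>Pow (edges G).
        scale (tag_counit (tag_vec (shrink G (subgraph G A)))) (tag_vec (subgraph G A)))"
      unfolding tag_comult_tag_vec_Pow[OF G]
      by (simp only: linear_map_sum[OF linear_map_structure_maps(5)[OF linear_map_ident(1)]]
          counit_right_tensor)
    also have "\<dots> = (\<Sum>A\<in>Pow (edges G). if A = edges G then tag_vec G else 0)"
      by (intro sum.cong refl)
        (auto simp: tag_counit_tag_vec is_tag_shrink[OF G] scale_simps subgraph_edges[OF G])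
    finally show "counit_right tag_counit (tag_comult (tag_vec G)) = tag_vec G"
      using G by (simp add: sum.delta is_tag_def)
  qed (intro linear_tag_maps)+
qed

section \<open>Compatibility of product and coproduct\<close>

lemma tag_comult_mult:
  "tag_comult (x \<cdot> y) = tensor_map tag_mult tag_mult (middle_swap (tag_comult x \<otimes> tag_comult y))"
proof (rule tag_space_eqI[of _ _ x])
  fix G :: "(nat, nat) graph"
  assume G: "is_tag G"
  show "tag_comult (tag_vec G \<cdot> y) =
    tensor_map tag_mult tag_mult (middle_swap (tag_comult (tag_vec G) \<otimes> tag_comult y))"
  proof (rule tag_space_eqI[of _ _ y])
    fix H :: "(nat, nat) graph"
    assume H: "is_tag H"
    let ?K = "ordinal_sum G H"
    \<comment> \<open>An edge set of the ordinal sum is determined by its preimages in the two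
      summands, so its subgraphs correspond to pairs of subgraphs.\<close>
    have bij: "bij_betw (\<lambda>(A, B). A <+> B) (Pow (edges G) \<times> Pow (edges H)) (Pow (edges ?K))"
    proof (rule bij_betw_byWitness[where f' = "\<lambda>C. (Inl -` C, Inr -` C)"])
      show "\<forall>C\<in>Pow (edges ?K). (\<lambda>(A, B). A <+> B) (Inl -` C, Inr -` C) = C"
        by (auto simp: Plus_def)
    qed (auto simp: Plus_def)
    have "tag_comult (tag_vec G \<cdot> tag_vec H) = (\<Sum>C\<in>Pow (edges ?K).
        tag_vec (subgraph ?K C) \<otimes> tag_vec (shrink ?K (subgraph ?K C)))"
      by (simp only: tag_mult_tag_vec[OF G H] tag_comult_tag_vec_Pow[OF is_tag_ordinal_sum[OF G H]])
    also have "\<dots> = (\<Sum>(A, B)\<in>Pow (edges G) \<times> Pow (edges H).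
        tag_vec (subgraph ?K (A <+> B)) \<otimes> tag_vec (shrink ?K (subgraph ?K (A <+> B))))"
      by (subst sum.reindex_bij_betw[OF bij, symmetric]) (simp add: case_prod_unfold)
    also have "\<dots> = (\<Sum>(A, B)\<in>Pow (edges G) \<times> Pow (edges H).
        (tag_vec (subgraph G A) \<cdot> tag_vec (subgraph H B)) \<otimes>
        (tag_vec (shrink G (subgraph G A)) \<cdot> tag_vec (shrink H (subgraph H B))))"
    proof (rule sum.cong[OF refl], clarify)
      fix A B assume AB: "A \<subseteq> edges G" "B \<subseteq> edges H"
      show "tag_vec (subgraph ?K (A <+> B)) \<otimes> tag_vec (shrink ?K (subgraph ?K (A <+> B))) =
          (tag_vec (subgraph G A) \<cdot> tag_vec (subgraph H B)) \<otimes>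
          (tag_vec (shrink G (subgraph G A)) \<cdot> tag_vec (shrink H (subgraph H B)))"
        by (simp only: tag_mult_tag_vec is_tag_subgraph[OF G AB(1)] is_tag_subgraph[OF H AB(2)]
            is_tag_shrink G H tag_of_subgraph_ordinal_sum[OF G H AB] tag_of_shrink_ordinal_sum[OF G H AB])
    qed
    also have "\<dots> = (\<Sum>A\<in>Pow (edges G). \<Sum>B\<in>Pow (edges H).
        (tag_vec (subgraph G A) \<cdot> tag_vec (subgraph H B)) \<otimes>
        (tag_vec (shrink G (subgraph G A)) \<cdot> tag_vec (shrink H (subgraph H B))))"
      by (rule sum.cartesian_product[symmetric])
    also have "\<dots> =
        tensor_map tag_mult tag_mult (middle_swap (tag_comult (tag_vec G) \<otimes> tag_comult (tag_vec H)))"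
      unfolding tag_comult_tag_vec_Pow[OF G] tag_comult_tag_vec_Pow[OF H]
      \<comment> \<open>Expanding the tensor product produces the two summations in the opposite
        order, hence the final exchange.\<close>
      by (simp only: tensor_sum_left tensor_sum_right middle_swap_basis
          linear_map_sum[OF linear_map_structure_maps(1)[OF linear_map_ident(1)]]
          linear_map_sum[OF linear_map_structure_maps(3)[OF linear_map_ident(1)]]
          tensor_map_tensor linear_tag_maps) (rule sum.swap)
    finally show "tag_comult (tag_vec G \<cdot> tag_vec H) =
        tensor_map tag_mult tag_mult (middle_swap (tag_comult (tag_vec G) \<otimes> tag_comult (tag_vec H)))" .
  qed (intro linear_tag_maps)+
qed (intro linear_tag_maps)+

lemma tag_counit_scale_unit: "tag_counit (scale c tag_unit) = c"
  by (simp add: tag_counit_def lookup_scale tag_unit_def)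

lemma tag_counit_mult: "tag_counit (x \<cdot> y) = tag_counit x * tag_counit y"
proof -
  have lin: "linear_map (\<lambda>x :: 'a tag_space. scale (tag_counit x) u)" for u :: "'a tag_space"
    by (rule linear_map_scale_form[OF linear_tag_counit])
  have lin': "linear_map (\<lambda>x :: 'a tag_space. scale c (scale (tag_counit x) u))" for c and u :: "'a tag_space"
    using linear_map_scale_form[OF linear_tag_counit, of "scale c u"] by (simp add: scale_simps mult.commute)
  \<comment> \<open>The scalars are compared as multiples of \<open>tag_unit\<close>, because
    \<open>tag_space_eqI\<close> applies to vector-valued maps; applying the counit recovers them at
    the end. On basis vectors the claim says that an ordinal sum is edgeless exactly when both
    summands are.\<close>
  have "scale (tag_counit (x \<cdot> y)) tag_unit = scale (tag_counit x) (scale (tag_counit y) tag_unit)"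
  proof (rule tag_space_eqI[of _ _ x])
    fix G :: "(nat, nat) graph"
    assume G: "is_tag G"
    show "scale (tag_counit (tag_vec G \<cdot> y)) tag_unit =
        scale (tag_counit (tag_vec G)) (scale (tag_counit y) tag_unit)"
    proof (rule tag_space_eqI[of _ _ y])
      fix H :: "(nat, nat) graph"
      assume H: "is_tag H"
      show "scale (tag_counit (tag_vec G \<cdot> tag_vec H)) tag_unit =
          scale (tag_counit (tag_vec G)) (scale (tag_counit (tag_vec H)) tag_unit)"
        using G H by (auto simp: tag_mult_tag_vec tag_counit_tag_vec is_tag_ordinal_sum scale_simps)
    qed (intro linear_map_compose[OF lin] lin' linear_tag_maps)+
  qed (intro linear_map_compose[OF lin] lin linear_tag_maps)+
  then show ?thesis
    by (metis scale_simps(3) tag_counit_scale_unit)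
qed

lemma tag_vec_subgraph_empty: "is_tag G \<Longrightarrow> tag_vec (subgraph G {}) = tag_unit"
  by (rule tag_vec_empty) (auto intro: is_tag_subgraph)

lemma tag_vec_shrink_self: "is_tag G \<Longrightarrow> tag_vec (shrink G G) = tag_unit"
  by (rule tag_vec_empty) (auto intro: is_tag_shrink)

lemma tag_comult_unit: "tag_comult tag_unit = tag_unit \<otimes> tag_unit"
proof -
  let ?E = "empty_graph :: (nat, nat) graph"
  have "edges ?E = {}" by (simp add: empty_graph_def)
  then have "tag_comult (tag_vec ?E) = tag_unit \<otimes> tag_unit"
    by (simp add: tag_comult_tag_vec_Pow is_tag_empty_graph tag_vec_subgraph_empty tag_of_shrink_empty)
      (simp add: tag_unit_def)
  then show ?thesis by (simp only: tag_unit_def)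
qed

lemma bialgebra_tag:
  "bialgebra (tag_mult :: (tag \<times> tag \<Rightarrow>\<^sub>0 'k::field) \<Rightarrow> 'k tag_space) tag_unit tag_comult tag_counit"
  by (intro bialgebra.intro unital_algebra.intro counital_coalgebra.intro bialgebra_axioms.intro
      linear_tag_mult tag_mult_assoc tag_mult_unit linear_tag_comult linear_tag_counit
      tag_comult_coassoc tag_counit_laws tag_comult_mult tag_comult_unit tag_counit_mult)
    (use tag_counit_scale_unit[of 1] in \<open>simp add: scale_one\<close>)


section \<open>The antipode\<close>

lemma convolution_tag_vec:
  assumes "linear_map f" "linear_map g" "is_tag G"
  shows "tag_mult (tensor_map f g (tag_comult (tag_vec G))) =
    (\<Sum>\<gamma>\<in>subgraphs G. f (tag_vec \<gamma>) \<cdot> g (tag_vec (shrink G \<gamma>)))"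
  by (simp only: tag_comult_tag_vec[OF assms(3)] tensor_map_tensor[OF assms(1,2)]
      linear_map_sum[OF linear_map_structure_maps(1)[OF linear_map_ident(1)]]
      linear_map_sum[OF linear_tag_mult])

text \<open>The presence of an edge makes the empty and the full subgraph distinct, so that they
  contribute two separate summands.\<close>

lemma sum_subgraphs_split:
  assumes "is_tag G" "edges G \<noteq> {}"
  shows "sum f (subgraphs G) = f (subgraph G {}) + f G + sum f (proper_subgraphs G)"
proof -
  have fin: "finite (subgraphs G)"
    using assms(1) by (simp add: subgraphs_def is_tag_def)
  have sub: "\<gamma> = subgraph G (edges \<gamma>)" if "\<gamma> \<in> subgraphs G" for \<gamma>
    using that by (auto simp: subgraphs_def)
  have "subgraphs G = {subgraph G {}, G} \<union> proper_subgraphs G"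
  proof
    show "subgraphs G \<subseteq> {subgraph G {}, G} \<union> proper_subgraphs G"
      using sub subgraph_edges[OF assms(1)] by (force simp: proper_subgraphs_def)
    show "{subgraph G {}, G} \<union> proper_subgraphs G \<subseteq> subgraphs G"
      using subgraph_edges[OF assms(1)] by (force simp: proper_subgraphs_def subgraphs_def)
  qed
  moreover have "{subgraph G {}, G} \<inter> proper_subgraphs G = {}"
    by (auto simp: proper_subgraphs_def)
  moreover have "subgraph G {} \<noteq> G" using assms(2) by (metis edges_subgraph)
  ultimately show ?thesis
    using fin by (simp add: sum.union_disjoint add.assoc)
qed

text \<open>For the termination of \<open>left_antipode\<close>: a recursive call goes to a class
  and so to a newly chosen representative, but the number of edges does not depend on that
  choice.\<close>

lemma card_edges_subgraph_less:
  assumes "A \<subset> edges (rep_tag t)"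
  shows "card (edges (rep_tag (tag_of (subgraph (rep_tag t) A)))) < card (edges (rep_tag t))"
proof -
  have "finite (edges (rep_tag t))" using is_tag_rep_tag by (simp add: is_tag_def)
  then show ?thesis
    using assms by (simp add: card_edges_rep_tag is_tag_subgraph is_tag_rep_tag
        psubset_imp_subset psubset_card_mono)
qed

lemma card_edges_shrink_less:
  assumes "A \<subseteq> edges (rep_tag t)" "A \<noteq> {}"
  shows "card (edges (rep_tag (tag_of (shrink (rep_tag t) (subgraph (rep_tag t) A))))) <
    card (edges (rep_tag t))"
proof -
  have "finite (edges (rep_tag t))" using is_tag_rep_tag by (simp add: is_tag_def)
  then show ?thesis
    using assms by (simp add: card_edges_rep_tag is_tag_shrink is_tag_rep_tag)
      (intro psubset_card_mono; auto)
qed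

text \<open>This solves \<open>S * id = unit counit\<close> for the summand
  \<open>A = edges (rep_tag t)\<close>, whose quotient is the unit. The index \<open>A = {}\<close>
  stays in the sum and contributes the class \<open>t\<close> itself.\<close>

function left_antipode :: "tag \<Rightarrow> 'k::field tag_space" where
  "left_antipode t =
    (if edges (rep_tag t) = {} then tag_unit else
     - (\<Sum>A\<in>{A. A \<subset> edges (rep_tag t)}. left_antipode (tag_of (subgraph (rep_tag t) A)) \<cdot>
          tag_vec (shrink (rep_tag t) (subgraph (rep_tag t) A))))"
  by auto
termination
  by (relation "measure (\<lambda>t. card (edges (rep_tag t)))") (auto intro: card_edges_subgraph_less)

text \<open>Here the summand solved for is \<open>A = {}\<close>, and the recursion passes to
  quotients; the index \<open>A = edges (rep_tag t)\<close> contributes the class \<open>t\<close>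
  itself.\<close>

function right_antipode :: "tag \<Rightarrow> 'k::field tag_space" where
  "right_antipode t =
    (if edges (rep_tag t) = {} then tag_unit else
     - (\<Sum>A\<in>{A. A \<subseteq> edges (rep_tag t) \<and> A \<noteq> {}}. tag_vec (subgraph (rep_tag t) A) \<cdot>
          right_antipode (tag_of (shrink (rep_tag t) (subgraph (rep_tag t) A)))))"
  by auto
termination
  by (relation "measure (\<lambda>t. card (edges (rep_tag t)))") (auto intro: card_edges_shrink_less)

declare left_antipode.simps [simp del] right_antipode.simps [simp del]

lemma left_antipode_inverse:
  "tag_mult (tensor_map (lin_ext left_antipode) id (tag_comult x)) = scale (tag_counit x) tag_unit"
proof (rule linear_map_eqI[of _ _ x])
  fix t
  let ?G = "rep_tag t"
  have G: "is_tag ?G" by (rule is_tag_rep_tag)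
  let ?h = "\<lambda>A. left_antipode (tag_of (subgraph ?G A)) \<cdot> tag_vec (shrink ?G (subgraph ?G A))"
  have fin: "finite {A. A \<subset> edges ?G}"
    by (rule finite_subset[of _ "Pow (edges ?G)"]) (use G in \<open>auto simp: is_tag_def\<close>)
  have "tag_mult (tensor_map (lin_ext left_antipode) id (tag_comult (basis t))) =
      (\<Sum>A\<in>Pow (edges ?G). ?h A)"
    using convolution_tag_vec[OF linear_lin_ext linear_map_ident(2) G, of left_antipode]
    by (simp only: tag_of_rep_tag sum_subgraphs lin_ext_basis id_apply)
  also have "Pow (edges ?G) = insert (edges ?G) {A. A \<subset> edges ?G}" by auto
  also have "(\<Sum>A\<in>insert (edges ?G) {A. A \<subset> edges ?G}. ?h A) =
      left_antipode t + (\<Sum>A\<in>{A. A \<subset> edges ?G}. ?h A)"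
    using fin by (simp add: subgraph_edges[OF G] tag_vec_shrink_self[OF G] tag_of_rep_tag tag_mult_unit)
  \<comment> \<open>Without edges the sum over proper subsets is empty and the counit is 1;
    otherwise the recursion makes the two terms cancel and the counit is 0.\<close>
  also have "\<dots> = scale (tag_counit (basis t)) tag_unit"
    by (subst left_antipode.simps)
      (simp add: tag_counit_tag_vec[OF G, unfolded tag_of_rep_tag] scale_simps)
  finally show "tag_mult (tensor_map (lin_ext left_antipode) id (tag_comult (basis t))) =
    scale (tag_counit (basis t)) tag_unit" .
qed (intro linear_tag_maps linear_map_scale_form linear_tag_counit)+

lemma right_antipode_inverse:
  "tag_mult (tensor_map id (lin_ext right_antipode) (tag_comult x)) = scale (tag_counit x) tag_unit"
proof (rule linear_map_eqI[of _ _ x])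
  fix t
  let ?G = "rep_tag t"
  have G: "is_tag ?G" by (rule is_tag_rep_tag)
  let ?h = "\<lambda>A. tag_vec (subgraph ?G A) \<cdot> right_antipode (tag_of (shrink ?G (subgraph ?G A)))"
  let ?X = "{A. A \<subseteq> edges ?G \<and> A \<noteq> {}}"
  have fin: "finite ?X"
    by (rule finite_subset[of _ "Pow (edges ?G)"]) (use G in \<open>auto simp: is_tag_def\<close>)
  have "tag_mult (tensor_map id (lin_ext right_antipode) (tag_comult (basis t))) =
      (\<Sum>A\<in>Pow (edges ?G). ?h A)"
    using convolution_tag_vec[OF linear_map_ident(2) linear_lin_ext G, of right_antipode]
    by (simp only: tag_of_rep_tag sum_subgraphs lin_ext_basis id_apply)
  also have "Pow (edges ?G) = insert {} ?X" by auto
  also have "(\<Sum>A\<in>insert {} ?X. ?h A) = right_antipode t + (\<Sum>A\<in>?X. ?h A)"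
    using fin by (simp add: tag_vec_subgraph_empty[OF G] tag_of_shrink_empty[OF G]
        tag_of_rep_tag tag_mult_unit)
  also have "\<dots> = scale (tag_counit (basis t)) tag_unit"
    by (subst right_antipode.simps)
      (simp add: tag_counit_tag_vec[OF G, unfolded tag_of_rep_tag] scale_simps)
  finally show "tag_mult (tensor_map id (lin_ext right_antipode) (tag_comult (basis t))) =
    scale (tag_counit (basis t)) tag_unit" .
qed (intro linear_tag_maps linear_map_scale_form linear_tag_counit)+

lemma is_antipode_left_antipode:
  "is_antipode tag_mult tag_unit tag_comult tag_counit
    (lin_ext left_antipode :: 'k::field tag_space \<Rightarrow> 'k tag_space)"
proof -
  interpret bialgebra "tag_mult :: (tag \<times> tag \<Rightarrow>\<^sub>0 'k) \<Rightarrow> 'k tag_space" tag_unit tag_comult tag_counit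
    by (rule bialgebra_tag)
  show ?thesis
    by (rule antipode_from_inverses[OF linear_lin_ext linear_lin_ext, of _ right_antipode])
      (simp_all add: conv_def fun_eq_iff left_antipode_inverse right_antipode_inverse)
qed

text \<open>The unit is grouplike with counit 1, so the left antipode equation at it reads
  \<open>S tag_unit \<cdot> tag_unit = tag_unit\<close>.\<close>

lemma antipode_tag_unit:
  assumes "is_antipode tag_mult tag_unit tag_comult tag_counit S"
  shows "S tag_unit = tag_unit"
proof -
  have "linear_map S"
    and "tag_mult (tensor_map S id (tag_comult tag_unit)) = scale (tag_counit tag_unit) tag_unit"
    using assms by (auto simp: is_antipode_def)
  then show ?thesis
    by (simp add: tag_comult_unit tensor_map_tensor linear_map_ident tag_mult_unit scale_simps
        tag_counit_scale_unit[of 1, unfolded scale_one])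
qed

text \<open>Each formula is one of the two antipode equations evaluated at \<open>G\<close>, where
  the counit vanishes. It thus holds for every \<open>S\<close> satisfying them, whatever its
  construction.\<close>

lemma antipode_tag_vec:
  assumes "is_antipode tag_mult tag_unit tag_comult tag_counit S" "is_tag G" "edges G \<noteq> {}"
  shows "S (tag_vec G) =
      - tag_vec G - (\<Sum>\<gamma>\<in>proper_subgraphs G. S (tag_vec \<gamma>) \<cdot> tag_vec (shrink G \<gamma>))"
    and "S (tag_vec G) =
      - tag_vec G - (\<Sum>\<gamma>\<in>proper_subgraphs G. tag_vec \<gamma> \<cdot> S (tag_vec (shrink G \<gamma>)))"
proof -
  have S: "linear_map S"
    "tag_mult (tensor_map S id (tag_comult (tag_vec G))) = scale (tag_counit (tag_vec G)) tag_unit"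
    "tag_mult (tensor_map id S (tag_comult (tag_vec G))) = scale (tag_counit (tag_vec G)) tag_unit"
    using assms(1) by (auto simp: is_antipode_def)
  have zero: "scale (tag_counit (tag_vec G)) tag_unit = 0"
    using assms(2,3) by (simp add: tag_counit_tag_vec scale_simps)
  note simps = sum_subgraphs_split[OF assms(2,3)] tag_vec_subgraph_empty[OF assms(2)]
    tag_vec_shrink_self[OF assms(2)] tag_of_shrink_empty[OF assms(2)]
    antipode_tag_unit[OF assms(1)] tag_mult_unit id_apply
  \<comment> \<open>The empty subgraph contributes \<open>S tag_unit \<cdot> tag_vec G\<close> and
    \<open>G\<close> itself contributes \<open>S (tag_vec G) \<cdot> tag_unit\<close>; in the second
    equation the two roles are exchanged.\<close>
  have "tag_vec G + S (tag_vec G) +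
      (\<Sum>\<gamma>\<in>proper_subgraphs G. S (tag_vec \<gamma>) \<cdot> tag_vec (shrink G \<gamma>)) = 0"
    using S(2) unfolding zero convolution_tag_vec[OF S(1) linear_map_ident(2) assms(2)] simps .
  then show "S (tag_vec G) =
      - tag_vec G - (\<Sum>\<gamma>\<in>proper_subgraphs G. S (tag_vec \<gamma>) \<cdot> tag_vec (shrink G \<gamma>))"
    by (simp add: algebra_simps eq_neg_iff_add_eq_0)
  have "S (tag_vec G) + tag_vec G +
      (\<Sum>\<gamma>\<in>proper_subgraphs G. tag_vec \<gamma> \<cdot> S (tag_vec (shrink G \<gamma>))) = 0"
    using S(3) unfolding zero convolution_tag_vec[OF linear_map_ident(2) S(1) assms(2)] simps .
  then show "S (tag_vec G) =
      - tag_vec G - (\<Sum>\<gamma>\<in>proper_subgraphs G. tag_vec \<gamma> \<cdot> S (tag_vec (shrink G \<gamma>)))"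
    by (simp add: algebra_simps eq_neg_iff_add_eq_0)
qed

theorem mainTheorem8:
  shows "hopf_algebra (tag_mult :: (tag \<times> tag \<Rightarrow>\<^sub>0 'k::field_char_0) \<Rightarrow> 'k tag_space)
           tag_unit tag_comult tag_counit \<and>
    (\<forall>S :: 'k tag_space \<Rightarrow> 'k tag_space.
       is_antipode tag_mult tag_unit tag_comult tag_counit S \<longrightarrow>
       S tag_unit = tag_unit \<and>
       (\<forall>G :: ('v, 'e) graph. is_tag G \<and> edges G \<noteq> {} \<longrightarrow>
          S (tag_vec G) =
            - tag_vec G - (\<Sum>\<gamma>\<in>proper_subgraphs G. S (tag_vec \<gamma>) \<cdot> tag_vec (shrink G \<gamma>)) \<and>
          S (tag_vec G) =
            - tag_vec G - (\<Sum>\<gamma>\<in>proper_subgraphs G. tag_vec \<gamma> \<cdot> S (tag_vec (shrink G \<gamma>)))))"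
proof (intro conjI allI impI)
  show "hopf_algebra (tag_mult :: (tag \<times> tag \<Rightarrow>\<^sub>0 'k) \<Rightarrow> 'k tag_space)
      tag_unit tag_comult tag_counit"
    using is_antipode_left_antipode
    by (intro hopf_algebra.intro bialgebra_tag hopf_algebra_axioms.intro) blast
qed (auto simp only: antipode_tag_unit intro: antipode_tag_vec)

end
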